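(* Let $\mathcal{G}=(\mathcal{N},\mathcal{E})$, $\mathcal{Q}_\mathcal{G}=\{1,\dots,q\}$, $A,B\in\mathbb{R}^{n\times n}$, $\mathcal{S}$, $E$, $M$, $\tilde A$, $\tilde B$, $\mathbb{D}$, $\mathbb{D}^{++}$ be as in the context, and suppose that $\mathcal{Q}_\mathcal{G}^i\neq\emptyset$ for all $i\in\mathcal{N}$ and that, for all distinct $i,j\in\mathcal{N}$, $\mathcal{Q}_\mathcal{G}^i\cap\mathcal{Q}_\mathcal{G}^j\neq\emptyset\Leftrightarrow(i,j)\in\mathcal{E}$. Define $$\mathcal{K}_\mathcal{S}=\{K\in\mathcal{S}:\exists P\in\mathcal{S},\ P\succ O\ \text{s.t.}\ (A+BK)^\top P+P(A+BK)\prec O\},$$ $$\Phi(\tilde Q,\tilde Z)=\tilde Q\tilde A^\top+\tilde A\tilde Q+\tilde Z^\top\tilde B^\top+\tilde B\tilde Z,$$ $$\hat{\mathcal{K}}_\mathcal{S}=\{(E^\top E)^{-1}E^\top(\tilde Z\tilde Q^{-1})E:\ \tilde Z\in\mathbb{D},\ \tilde Q\in\mathbb{D}^{++},\ \exists\rho\in\mathbb{R}\ \text{s.t.}\ \Phi(\tilde Q,\tilde Z)+\rho\,\tilde Q M\tilde Q\prec O\}.$$ Then $\hat{\mathcal{K}}_\mathcal{S}\subset\mathcal{K}_\mathcal{S}$. Moreover, $\hat{\mathcal{K}}_\mathcal{S}=\mathcal{K}_\mathcal{S}$ if $\mathcal{G}$ is chordal and $\mathcal{Q}_\mathcal{G}$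 is the index set of all maximal cliques of $\mathcal{G}$.
   Context: $\mathcal{G}=(\mathcal{N},\mathcal{E})$ is an undirected graph with $\mathcal{N}=\{1,\dots,N\}$; $\mathcal{E}$ is a set of pairs $(i,j)$ of distinct nodes with $(i,j)\in\mathcal{E}\Leftrightarrow(j,i)\in\mathcal{E}$. A clique is a nonempty $\mathcal{C}\subset\mathcal{N}$ with $(i,j)\in\mathcal{E}$ for all distinct $i,j\in\mathcal{C}$; it is maximal if not contained in another clique. $\mathcal{G}$ is chordal if every cycle of length at least four has a chord. $\mathcal{Q}_\mathcal{G}=\{1,\dots,q\}$ indexes a collection of distinct cliques $\mathcal{C}_1,\dots,\mathcal{C}_q$ of $\mathcal{G}$ (not necessarily all, not necessarily maximal), and $\mathcal{Q}_\mathcal{G}^i=\{k\in\mathcal{Q}_\mathcal{G}: i\in\mathcal{C}_k\}$. Let $n=\sum_{i=1}^N n_i$ with positive integers $n_i$; $n\times n$ matrices are partitioned into blocks $K_{ij}\in\mathbb{R}^{n_i\times n_j}$ (state and input dimensions of each subsystem are taken equal). Define $\mathcal{S}=\{K\in\mathbb{R}^{n\times n}:K_{ij}=O\text{ if }(i,j)\notin\mathcal{E},\ i\neq j\}$. $E_j=[O_{n_j\times n_1},\dots,I_{n_j},\dots,O_{n_j\times n_N}]\in\mathbb{R}^{n_j\times n}$ (identity in the $j$th block). $n_{\mathcal{C}_k}=\sum_{j\in\mathcal{C}_k}n_j$; $E_{\mathcal{C}_k}\in\mathbb{R}^{n_{\mathcal{C}_k}\times n}$ is obtained by stacking the $E_j$,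 $j\in\mathcal{C}_k$, vertically (in increasing order of $j$); $E=[E_{\mathcal{C}_1}^\top,\dots,E_{\mathcal{C}_q}^\top]^\top$. When all $\mathcal{Q}_\mathcal{G}^i\ne\emptyset$, $E^\top E$ is invertible (block diagonal with blocks $|\mathcal{Q}_\mathcal{G}^i|I_{n_i}$). $M=I-E(E^\top E)^{-1}E^\top$, $\tilde A=EA(E^\top E)^{-1}E^\top$, $\tilde B=EB(E^\top E)^{-1}E^\top$. $\mathbb{D}=\{\mathrm{blkdiag}(\tilde P_1,\dots,\tilde P_q):\tilde P_k\in\mathbb{R}^{n_{\mathcal{C}_k}\times n_{\mathcal{C}_k}}\}$, and $\mathbb{D}^{++}$ is the subset of those with every $\tilde P_k\succ O$. $X\succ O$ ($X\prec O$) means symmetric positive (negative) definite. *)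

theory Defs
  imports "Jordan_Normal_Form.Gauss_Jordan_Elimination" "Graph_Theory.Pair_Digraph"
begin

section \<open>Cliques and chordal graphs\<close>

definition is_clique :: "nat pair_pre_digraph \<Rightarrow> nat set \<Rightarrow> bool" where
  "is_clique G S \<longleftrightarrow> S \<noteq> {} \<and> S \<subseteq> pverts G \<and>
     (\<forall>i\<in>S. \<forall>j\<in>S. i \<noteq> j \<longrightarrow> (i, j) \<in> parcs G)"

definition is_maximal_clique :: "nat pair_pre_digraph \<Rightarrow> nat set \<Rightarrow> bool" where
  "is_maximal_clique G S \<longleftrightarrow> is_clique G S \<and> \<not> (\<exists>T. is_clique G T \<and> S \<subset> T)"

text \<open>
  A cycle of a symmetric digraph is a list of arcs, whose vertices are the tails of these arcs.
  For length at least three these are the cycles of the underlying undirected graph, each with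
  a starting point and an orientation.  A chord is an edge joining two vertices of the cycle
  which is not, in either orientation, an edge of the cycle.
\<close>

definition chordal :: "nat pair_pre_digraph \<Rightarrow> bool" where
  "chordal G \<longleftrightarrow> (\<forall>p. pre_digraph.cycle (with_proj G) p \<and> 4 \<le> length p \<longrightarrow>
     (\<exists>x \<in> fst ` set p. \<exists>y \<in> fst ` set p.
        (x, y) \<in> parcs G \<and> (x, y) \<notin> set p \<and> (y, x) \<notin> set p))"

text \<open>
  The cliques are \<open>C 1, \<dots>, C q\<close>; the values of \<open>C\<close> outside \<open>{1..q}\<close> are irrelevant.
\<close>

definition clique_indices :: "nat \<Rightarrow> (nat \<Rightarrow> nat set) \<Rightarrow> nat \<Rightarrow> nat set" where
  "clique_indices q C i = {k \<in> {1..q}. i \<in> C k}"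

section \<open>Definite matrices and inverses\<close>

definition pos_def :: "real mat \<Rightarrow> bool" where
  "pos_def X \<longleftrightarrow> square_mat X \<and> transpose_mat X = X \<and>
     (\<forall>v \<in> carrier_vec (dim_row X). v \<noteq> 0\<^sub>v (dim_row X) \<longrightarrow> 0 < v \<bullet> (X *\<^sub>v v))"

definition neg_def :: "real mat \<Rightarrow> bool" where
  "neg_def X \<longleftrightarrow> square_mat X \<and> transpose_mat X = X \<and>
     (\<forall>v \<in> carrier_vec (dim_row X). v \<noteq> 0\<^sub>v (dim_row X) \<longrightarrow> v \<bullet> (X *\<^sub>v v) < 0)"

text \<open>Unspecified for singular matrices; it is only used for invertible ones.\<close>

definition minv :: "real mat \<Rightarrow> real mat" where
  "minv X = the (mat_inverse X)"

section \<open>Block structure\<close>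

text \<open>
  Subsystems are numbered \<open>1, \<dots>, N\<close>, and subsystem \<open>i\<close> has dimension \<open>d i\<close>.  As matrix
  indices start at 0, it occupies the indices \<open>offset d i, \<dots>, offset d i + d i - 1\<close>.
\<close>

definition total_dim :: "nat \<Rightarrow> (nat \<Rightarrow> nat) \<Rightarrow> nat" where
  "total_dim N d = (\<Sum>i\<in>{1..N}. d i)"

definition offset :: "(nat \<Rightarrow> nat) \<Rightarrow> nat \<Rightarrow> nat" where
  "offset d i = (\<Sum>j\<in>{1..<i}. d j)"

definition block :: "(nat \<Rightarrow> nat) \<Rightarrow> real mat \<Rightarrow> nat \<Rightarrow> nat \<Rightarrow> real mat" where
  "block d K i j = mat (d i) (d j) (\<lambda>(r, c). K $$ (offset d i + r, offset d j + c))"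

definition sparse_mats :: "nat pair_pre_digraph \<Rightarrow> nat \<Rightarrow> (nat \<Rightarrow> nat) \<Rightarrow> real mat set" where
  "sparse_mats G N d = {K \<in> carrier_mat (total_dim N d) (total_dim N d).
     \<forall>i\<in>{1..N}. \<forall>j\<in>{1..N}. (i, j) \<notin> parcs G \<and> i \<noteq> j \<longrightarrow> block d K i j = 0\<^sub>m (d i) (d j)}"

definition vstack :: "nat \<Rightarrow> real mat list \<Rightarrow> real mat" where
  "vstack n Xs = foldr append_rows Xs (0\<^sub>m 0 n)"

definition E_node :: "nat \<Rightarrow> (nat \<Rightarrow> nat) \<Rightarrow> nat \<Rightarrow> real mat" where
  "E_node N d j = mat (d j) (total_dim N d) (\<lambda>(r, c). if c = offset d j + r then 1 else 0)"

definition E_clique :: "nat \<Rightarrow> (nat \<Rightarrow> nat) \<Rightarrow> nat set \<Rightarrow> real mat" where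
  "E_clique N d S = vstack (total_dim N d) (map (E_node N d) (sorted_list_of_set S))"

definition E_mat :: "nat \<Rightarrow> (nat \<Rightarrow> nat) \<Rightarrow> nat \<Rightarrow> (nat \<Rightarrow> nat set) \<Rightarrow> real mat" where
  "E_mat N d q C = vstack (total_dim N d) (map (\<lambda>k. E_clique N d (C k)) [1..<Suc q])"

definition clique_dim :: "(nat \<Rightarrow> nat) \<Rightarrow> nat set \<Rightarrow> nat" where
  "clique_dim d S = (\<Sum>j\<in>S. d j)"

definition M_mat :: "real mat \<Rightarrow> real mat" where
  "M_mat E = 1\<^sub>m (dim_row E) - E * minv (transpose_mat E * E) * transpose_mat E"

text \<open>The lifted matrix is \<open>A\<close> with a tilde for \<open>X = A\<close>, and \<open>B\<close> with a tilde for \<open>X = B\<close>.\<close>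

definition lift_mat :: "real mat \<Rightarrow> real mat \<Rightarrow> real mat" where
  "lift_mat E X = E * X * minv (transpose_mat E * E) * transpose_mat E"

definition blkdiag :: "nat \<Rightarrow> (nat \<Rightarrow> real mat) \<Rightarrow> real mat" where
  "blkdiag q P = diag_block_mat (map P [1..<Suc q])"

definition DD :: "(nat \<Rightarrow> nat) \<Rightarrow> nat \<Rightarrow> (nat \<Rightarrow> nat set) \<Rightarrow> real mat set" where
  "DD d q C = {blkdiag q P | P.
     \<forall>k\<in>{1..q}. P k \<in> carrier_mat (clique_dim d (C k)) (clique_dim d (C k))}"

definition DDpp :: "(nat \<Rightarrow> nat) \<Rightarrow> nat \<Rightarrow> (nat \<Rightarrow> nat set) \<Rightarrow> real mat set" where
  "DDpp d q C = {blkdiag q P | P.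
     \<forall>k\<in>{1..q}. P k \<in> carrier_mat (clique_dim d (C k)) (clique_dim d (C k)) \<and> pos_def (P k)}"

section \<open>Sets of structured stabilizing gains\<close>

definition K_S :: "nat pair_pre_digraph \<Rightarrow> nat \<Rightarrow> (nat \<Rightarrow> nat) \<Rightarrow> real mat \<Rightarrow> real mat
    \<Rightarrow> real mat set" where
  "K_S G N d A B = {K \<in> sparse_mats G N d. \<exists>P \<in> sparse_mats G N d. pos_def P \<and>
     neg_def (transpose_mat (A + B * K) * P + P * (A + B * K))}"

text \<open>The first two arguments of \<open>Phi\<close> are the lifted versions of \<open>A\<close> and \<open>B\<close>.\<close>

definition Phi :: "real mat \<Rightarrow> real mat \<Rightarrow> real mat \<Rightarrow> real mat \<Rightarrow> real mat" where
  "Phi At Bt Q Z = Q * transpose_mat At + At * Q + transpose_mat Z * transpose_mat Bt + Bt * Z"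

definition K_S_hat :: "nat \<Rightarrow> (nat \<Rightarrow> nat) \<Rightarrow> nat \<Rightarrow> (nat \<Rightarrow> nat set) \<Rightarrow> real mat \<Rightarrow> real mat
    \<Rightarrow> real mat set" where
  "K_S_hat N d q C A B = (let E = E_mat N d q C in
     {minv (transpose_mat E * E) * transpose_mat E * (Z * minv Q) * E | Z Q.
        Z \<in> DD d q C \<and> Q \<in> DDpp d q C \<and>
        (\<exists>\<rho>::real. neg_def (Phi (lift_mat E A) (lift_mat E B) Q Z + \<rho> \<cdot>\<^sub>m (Q * M_mat E * Q)))})"

end

theory Submission
  imports Defs "Jordan_Normal_Form.Determinant"
begin

text \<open>
  Substituting \<open>v = Q\<^sup>-\<^sup>1 w\<close> turns the lifted inequality into one for a quadratic form in \<open>w\<close> which,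
  restricted to the range of \<open>E\<close>, is the Lyapunov inequality for \<open>P = E\<^sup>T Q\<^sup>-\<^sup>1 E\<close>; as \<open>M\<close> is the
  orthogonal projection with kernel the range of \<open>E\<close>, Finsler's lemma shows that the two are
  equivalent.  It remains to see which pairs \<open>(K, P)\<close> arise.  Every sparse \<open>K\<close> does, since each
  edge lies in a clique.  For chordal graphs and all maximal cliques every sparse positive
  definite \<open>P\<close> does as well, by Cholesky elimination along a perfect elimination order.
\<close>

text \<open>\<open>Z\<close> and \<open>Q\<close> enter the inequality together, yet with
  \<open>W\<close> the inverse of \<open>Q\<close> and \<open>Kt = Z * W\<close> they separate:
  block-diagonal matrices are closed under products and, when definite, under inverses, so
  \<open>Kt\<close> ranges over all of \<open>DD\<close> and \<open>W\<close>, independently, over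
  all of \<open>DDpp\<close>. The gain becomes \<open>F * Kt * E\<close> and the Lyapunov matrix
  \<open>transpose_mat E * W * E\<close>, where \<open>F\<close> is the left inverse (E^T E)^-1 E^T
  of \<open>E\<close>. A product \<open>transpose_mat E * D * E\<close> is the sum of the blocks of
  \<open>D\<close>, each padded with zeros outside its clique, and passing to \<open>F\<close> only
  rescales rows. For a gain it is therefore enough to hand each entry to some clique. For a Lyapunov
  matrix the summands must also be definite, which handing out entries does not achieve; this is
  where chordality enters. The elimination works on scalar indices, several of which may belong to
  one node, and must cope with zero pivots because it is applied to a matrix that is only
  semidefinite.\<close>

section \<open>Chordal graphs\<close>

text \<open>Only the interior is confined to \<open>Y\<close>: in the application the ends are
  neighbours of a vertex \<open>u\<close> and \<open>Y\<close> consists of its non-neighbours. Walks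
  are functions with a length, so that shortcuts are index shifts.\<close>

definition walk_through :: "('a \<times> 'a) set \<Rightarrow> 'a set \<Rightarrow> 'a \<Rightarrow> 'a \<Rightarrow> nat \<Rightarrow> (nat \<Rightarrow> 'a) \<Rightarrow> bool" where
  "walk_through R Y s t n f \<longleftrightarrow> f 0 = s \<and> f n = t \<and> (\<forall>i<n. (f i, f (Suc i)) \<in> R) \<and>
     (\<forall>i. 0 < i \<and> i < n \<longrightarrow> f i \<in> Y)"

lemma walk_through_shorten_eq:
  assumes w: "walk_through R Y s t n f" and ij: "i < j" "j \<le> n" and eq: "f i = f j"
  shows "\<exists>m<n. \<exists>g. walk_through R Y s t m g"
proof (intro exI conjI)
  let ?g = "\<lambda>k. if k \<le> i then f k else f (k + (j - i))"
  show "n - (j - i) < n" using ij by simp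
  have "(?g k, ?g (Suc k)) \<in> R" if "k < n - (j - i)" for k
  proof (cases "k = i")
    case True
    then show ?thesis using w that ij eq by (auto simp: walk_through_def)
  next
    case False
    then show ?thesis using w that ij by (auto simp: walk_through_def)
  qed
  \<comment> \<open>If the detour reaches the end (\<open>j = n\<close>), the new last index is
    \<open>i\<close>, which falls under the first branch of \<open>?g\<close>; there
    \<open>f i = f j\<close> gives \<open>t\<close>.\<close>
  moreover have "?g (n - (j - i)) = t"
  proof (cases "j = n")
    case True
    then show ?thesis using w ij eq by (simp add: walk_through_def)
  next
    case False
    then show ?thesis using w ij by (simp add: walk_through_def)
  qed
  ultimately show "walk_through R Y s t (n - (j - i)) ?g"
    using w ij unfolding walk_through_def by auto
qed

lemma walk_through_shorten_chord:
  assumes w: "walk_through R Y s t n f" and ij: "Suc i < j" "j \<le> n" and ch: "(f i, f j) \<in> R"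
  shows "\<exists>m<n. \<exists>g. walk_through R Y s t m g"
proof (intro exI conjI)
  let ?g = "\<lambda>k. if k \<le> i then f k else f (k + (j - Suc i))"
  show "n - (j - Suc i) < n" using ij by simp
  have "(?g k, ?g (Suc k)) \<in> R" if "k < n - (j - Suc i)" for k
  proof (cases "k = i")
    case True
    then show ?thesis using w that ij ch by (auto simp: walk_through_def)
  next
    case False
    then show ?thesis using w that ij by (auto simp: walk_through_def)
  qed
  moreover have "?g (n - (j - Suc i)) = t"
    using w ij by (auto simp: walk_through_def)
  ultimately show "walk_through R Y s t (n - (j - Suc i)) ?g"
    using w ij unfolding walk_through_def by auto
qed

text \<open>A walk of least length admits neither kind of shortcut: a repeated vertex or a chord
  would give a shorter one with the same ends.\<close>

lemma induced_walk_exists: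
  assumes "walk_through R Y s t n f"
  obtains m g where "walk_through R Y s t m g" "inj_on g {0..m}"
    "\<And>i j. Suc i < j \<Longrightarrow> j \<le> m \<Longrightarrow> (g i, g j) \<notin> R"
proof -
  define m where "m = (LEAST m. \<exists>g. walk_through R Y s t m g)"
  have "\<exists>g. walk_through R Y s t m g"
    unfolding m_def by (rule LeastI_ex) (use assms in blast)
  then obtain g where g: "walk_through R Y s t m g" by blast
  have min: "\<not> (\<exists>k<m. \<exists>g. walk_through R Y s t k g)"
    using not_less_Least m_def by blast
  have "g i \<noteq> g j" if "i < j" "j \<le> m" for i j
    using walk_through_shorten_eq[OF g that] min by blast
  then have "inj_on g {0..m}"
    by (intro inj_onI) (metis atLeastAtMost_iff linorder_neqE_nat)
  then show thesis using that g walk_through_shorten_chord[OF g] min by blast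
qed

lemma pcas_map_walk:
  "pcas (f 0) (map (\<lambda>i. (f i, f (Suc i))) [0..<n]) (f n)"
proof -
  \<comment> \<open>The start is generalised because the induction peels off the first arc.\<close>
  have "pcas (f k) (map (\<lambda>i. (f i, f (Suc i))) [k..<k + n]) (f (k + n))" for k
  proof (induction n arbitrary: k)
    case (Suc n)
    show ?case using Suc[of "Suc k"] by (simp add: upt_conv_Cons del: upt_Suc)
  qed simp
  from this[of 0] show ?thesis by simp
qed

lemma pcas_snoc: "pcas u p v \<Longrightarrow> pcas u (p @ [(v, w)]) w"
  by (induction u p v rule: pcas.induct) auto

lemma pair_graph_sym: "pair_graph G \<Longrightarrow> (x, y) \<in> parcs G \<Longrightarrow> (y, x) \<in> parcs G"
  using pair_graph.axioms(2) pair_pseudo_graph.axioms(2) pair_sym_digraph.pair_sym_arcs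
  by (metis symmetric_def symD with_proj_simps(3))

lemma pair_graph_irrefl: "pair_graph G \<Longrightarrow> (x, x) \<notin> parcs G"
  using pair_graph.axioms(1) pair_digraph.axioms(2) pair_loopfree_digraph.pair_no_loops by fastforce

lemma pair_graph_verts: "pair_graph G \<Longrightarrow> (x, y) \<in> parcs G \<Longrightarrow> x \<in> pverts G \<and> y \<in> pverts G"
  using pair_graph.axioms(1) pair_digraph.pair_wf_digraph pair_wf_digraph.wellformed' by metis

text \<open>Closing the path through \<open>u\<close> gives a cycle of \<open>n + 2\<close> arcs. A
  chord would either join nonconsecutive path vertices, which inducedness forbids, or lead from
  \<open>u\<close> to an interior vertex, which lies in \<open>Y\<close> and so is no neighbour of
  \<open>u\<close>.\<close>

lemma chordal_no_induced_cycle: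
  assumes G: "pair_graph G" and ch: "chordal G"
    and w: "walk_through (parcs G) Y s t n f" and n: "2 \<le> n"
    and inj: "inj_on f {0..n}"
    and ind: "\<And>i j. Suc i < j \<Longrightarrow> j \<le> n \<Longrightarrow> (f i, f j) \<notin> parcs G"
    and us: "(u, s) \<in> parcs G" and ut: "(u, t) \<in> parcs G"
    and Y: "\<And>y. y \<in> Y \<Longrightarrow> y \<noteq> u \<and> (u, y) \<notin> parcs G"
  shows False
proof -
  note sym = pair_graph_sym[OF G] and irr = pair_graph_irrefl[OF G] and V = pair_graph_verts[OF G]
  have f0: "f 0 = s" and fn: "f n = t" and fE: "\<And>i. i < n \<Longrightarrow> (f i, f (Suc i)) \<in> parcs G"
    and fY: "\<And>i. 0 < i \<Longrightarrow> i < n \<Longrightarrow> f i \<in> Y"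
    using w by (auto simp: walk_through_def)
  define q where "q = map (\<lambda>i. (f i, f (Suc i))) [0..<n]"
  define p where "p = (u, f 0) # q @ [(f n, u)]"
  have fu: "f i \<noteq> u" if "i \<le> n" for i
    using that f0 fn us ut irr Y[OF fY[of i]] by (metis le_neq_implies_less not_gr_zero)
  have setp: "set p \<subseteq> parcs G"
    using fE us ut sym f0 fn by (auto simp: p_def q_def)
  have cas: "pcas u p u"
    unfolding p_def q_def by (simp add: pcas_snoc pcas_map_walk)
  have verts: "map fst p = u # map f [0..<Suc n]"
    by (simp add: p_def q_def comp_def)
  have "distinct (map fst p)"
    unfolding verts using inj fu
    by (auto simp: distinct_map atLeastLessThanSuc_atLeastAtMost simp del: upt_Suc dest: fu)
  moreover have "pre_digraph.awalk_verts (with_proj G) u p = map fst p @ [u]"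
    unfolding pre_digraph.awalk_verts_conv by (simp add: p_def)
  ultimately have "distinct (tl (pre_digraph.awalk_verts (with_proj G) u p))"
    by (simp add: verts)
  moreover have "pre_digraph.awalk (with_proj G) u p u"
    unfolding pre_digraph.awalk_def cas_with_proj_eq using cas setp V us by auto
  moreover have "p \<noteq> []" by (simp add: p_def)
  ultimately have "pre_digraph.cycle (with_proj G) p"
    unfolding pre_digraph.cycle_def by blast
  moreover have "4 \<le> length p" using n by (simp add: p_def q_def)
  ultimately obtain x y where xy: "x \<in> set (map fst p)" "y \<in> set (map fst p)" "(x, y) \<in> parcs G"
    "(x, y) \<notin> set p" "(y, x) \<notin> set p"
    using ch unfolding chordal_def by (metis list.set_map)
  have u_case: False if "i \<le> n" "(u, f i) \<in> parcs G" "(u, f i) \<notin> set p" "(f i, u) \<notin> set p" for i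
  proof -
    have "i \<noteq> 0" using that by (intro notI) (auto simp: p_def)
    moreover have "i \<noteq> n" using that by (intro notI) (auto simp: p_def)
    ultimately show False using fY[of i] Y[of "f i"] that by auto
  qed
  have f_case: False
    if "i < j" "j \<le> n" "(f i, f j) \<in> parcs G" "(f i, f j) \<notin> set p" for i j
  proof (cases "j = Suc i")
    case True
    then have "(f i, f j) \<in> set q" using that by (auto simp: q_def)
    then show False using that by (auto simp: p_def)
  next
    case False
    then show False using ind[of i j] that by simp
  qed
  have "x \<noteq> y" using xy irr by blast
  have "x = u \<or> (\<exists>i\<le>n. x = f i)" "y = u \<or> (\<exists>i\<le>n. y = f i)"
    using xy(1,2) unfolding verts by (auto simp: less_Suc_eq_le simp del: upt_Suc)
  then show False
    using u_case f_case xy(3-5) sym[OF xy(3)] \<open>x \<noteq> y\<close> by (smt (verit) linorder_neqE_nat)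
qed

text \<open>Relative to a vertex set, so that eliminating nodes shrinks \<open>X\<close> while the
  graph and its chordality stay fixed.\<close>

definition simplicial_in :: "('a \<times> 'a) set \<Rightarrow> 'a set \<Rightarrow> 'a \<Rightarrow> bool" where
  "simplicial_in R X v \<longleftrightarrow> v \<in> X \<and>
     (\<forall>x\<in>X. \<forall>y\<in>X. (v, x) \<in> R \<longrightarrow> (v, y) \<in> R \<longrightarrow> x \<noteq> y \<longrightarrow> (x, y) \<in> R)"

text \<open>
  Dirac's theorem, strengthened so that the induction goes through: a component \<open>D\<close> of the
  non-neighbours of \<open>u\<close> has a complete neighbourhood \<open>S\<close>, and the induction hypothesis for
  \<open>D \<union> S\<close> is applied to a vertex chosen such that the resulting simplicial vertex lies in \<open>D\<close>.
\<close>

lemma simplicial_nonneighbour: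
  assumes G: "pair_graph G" and ch: "chordal G"
    and "finite X" "u \<in> X" "w \<in> X" "w \<noteq> u" "(u, w) \<notin> parcs G"
  shows "\<exists>v. simplicial_in (parcs G) X v \<and> v \<noteq> u \<and> (u, v) \<notin> parcs G"
  using assms(3-)
proof (induction "card X" arbitrary: X u w rule: less_induct)
  case less
  note sym = pair_graph_sym[OF G] and irr = pair_graph_irrefl[OF G]
  let ?E = "parcs G"
  define Y where "Y = {y \<in> X. y \<noteq> u \<and> (u, y) \<notin> ?E}"
  define R where "R = {(x, y). x \<in> Y \<and> y \<in> Y \<and> (x, y) \<in> ?E}"
  define D where "D = R\<^sup>* `` {w}"
  define S where "S = {s \<in> X. (u, s) \<in> ?E \<and> (\<exists>d\<in>D. (s, d) \<in> ?E)}"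
  have wY: "w \<in> Y" using less.prems by (simp add: Y_def)
  have wD: "w \<in> D" by (simp add: D_def)
  have DY: "D \<subseteq> Y"
  proof
    fix x assume "x \<in> D"
    then have "(w, x) \<in> R\<^sup>*" by (simp add: D_def)
    then show "x \<in> Y" using wY by (induction rule: rtrancl_induct) (auto simp: R_def)
  qed
  have symR: "sym R" unfolding R_def by (rule symI) (use sym in auto)
  have Dconn: "(x, y) \<in> R\<^sup>*" if "x \<in> D" "y \<in> D" for x y
    using that sym_rtrancl[OF symR] unfolding D_def by (meson Image_singleton_iff rtrancl_trans symD)
  \<comment> \<open>Nonadjacent \<open>s\<close> and \<open>t\<close> would be joined by a walk with
    interior in \<open>D\<close>; a shortest walk through \<open>Y\<close>, closed at
    \<open>u\<close>, is then a chordless cycle.\<close>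
  have S_clique: "(s, t) \<in> ?E" if st: "s \<in> S" "t \<in> S" "s \<noteq> t" for s t
  proof (rule ccontr)
    assume nst: "(s, t) \<notin> ?E"
    obtain d e where d: "d \<in> D" "(s, d) \<in> ?E" and e: "e \<in> D" "(t, e) \<in> ?E"
      using st unfolding S_def by auto
    obtain n where "(d, e) \<in> R ^^ n" using Dconn[OF d(1) e(1)] rtrancl_imp_relpow by blast
    then obtain f where f: "f 0 = d" "f n = e" "\<And>i. i < n \<Longrightarrow> (f i, f (Suc i)) \<in> R"
      by (auto simp: relpow_fun_conv)
    have fY: "f i \<in> Y" if "i \<le> n" for i
    proof (cases i)
      case 0
      then show ?thesis using f d DY by auto
    next
      case (Suc j)
      then show ?thesis using f(3)[of j] that by (simp add: R_def)
    qed
    \<comment> \<open>The walk from \<open>d\<close> to \<open>e\<close> with \<open>s\<close> put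
      in front and \<open>t\<close> behind, hence the index shift and the length
      \<open>n + 2\<close>.\<close>
    define h where "h k = (if k = 0 then s else if k \<le> Suc n then f (k - 1) else t)" for k
    have "walk_through ?E Y s t (Suc (Suc n)) h"
      unfolding walk_through_def
    proof (intro conjI allI impI)
      fix i assume i: "i < Suc (Suc n)"
      consider "i = 0" | "0 < i" "i \<le> n" | "i = Suc n" using i by linarith
      then show "(h i, h (Suc i)) \<in> ?E"
      proof cases
        case 2
        then obtain j where "i = Suc j" using gr0_implies_Suc by blast
        then show ?thesis using f(3)[of j] 2 by (simp add: h_def R_def)
      qed (use f d e sym in \<open>auto simp: h_def\<close>)
    qed (use fY in \<open>auto simp: h_def\<close>)
    then obtain m g where g: "walk_through ?E Y s t m g" "inj_on g {0..m}"
      "\<And>i j. Suc i < j \<Longrightarrow> j \<le> m \<Longrightarrow> (g i, g j) \<notin> ?E"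
      by (rule induced_walk_exists) blast
    have "m \<noteq> 0" using g(1) st by (intro notI) (auto simp: walk_through_def)
    moreover have "m \<noteq> 1" using g(1) nst by (intro notI) (auto simp: walk_through_def)
    ultimately have "2 \<le> m" by simp
    then show False
      by (rule chordal_no_induced_cycle[OF G ch g(1) _ g(2,3)]) (use st in \<open>auto simp: S_def Y_def\<close>)
  qed
  \<comment> \<open>A neighbour of the component is adjacent to \<open>u\<close>, and then in
    \<open>S\<close>, or belongs to the component itself. Hence a vertex of \<open>D\<close> has the
    same neighbours in \<open>X\<close> as in \<open>D \<union> S\<close>, and being simplicial
    carries over.\<close>
  have D_nbrs: "y \<in> D \<union> S" if "x \<in> D" "y \<in> X" "(x, y) \<in> ?E" for x y
  proof (cases "(u, y) \<in> ?E")
    case True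
    then show ?thesis using that sym by (auto simp: S_def)
  next
    case False
    moreover have "y \<noteq> u" using that DY sym by (auto simp: Y_def)
    ultimately have "(x, y) \<in> R" using that DY by (auto simp: R_def Y_def)
    then show ?thesis using that(1) unfolding D_def by (auto intro: rtrancl_into_rtrancl)
  qed
  have lift: "\<exists>v. simplicial_in ?E X v \<and> v \<noteq> u \<and> (u, v) \<notin> ?E"
    if v: "simplicial_in ?E (D \<union> S) v" "v \<in> D" for v
  proof -
    have "simplicial_in ?E X v"
      unfolding simplicial_in_def
    proof (intro conjI ballI impI)
      show "v \<in> X" using v DY by (auto simp: Y_def)
      fix x y assume "x \<in> X" "y \<in> X" "(v, x) \<in> ?E" "(v, y) \<in> ?E" "x \<noteq> y"
      moreover from this have "x \<in> D \<union> S" "y \<in> D \<union> S" using D_nbrs v(2) by blast+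
      ultimately show "(x, y) \<in> ?E" using v(1) unfolding simplicial_in_def by blast
    qed
    then show ?thesis using v DY by (auto simp: Y_def)
  qed
  have sub: "D \<union> S \<subseteq> X - {u}" using DY irr by (auto simp: Y_def S_def)
  then have card: "card (D \<union> S) < card X"
    using less.prems by (metis Diff_subset Un_iff card_Diff1_less card_mono finite_Diff order_le_less_trans)
  have fin: "finite (D \<union> S)" using sub less.prems finite_subset by blast
  note IH = less.hyps[OF card fin]
  \<comment> \<open>If some \<open>s\<close> in \<open>S\<close> misses a vertex, it serves as the
    base of the induction hypothesis: the vertex found is not adjacent to \<open>s\<close>, so,
    \<open>S\<close> being complete, it lies in \<open>D\<close>.\<close>
  show ?case
  proof (cases "\<exists>s\<in>S. \<exists>y\<in>D \<union> S. y \<noteq> s \<and> (s, y) \<notin> ?E")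
    case True
    then obtain s y where s: "s \<in> S" "y \<in> D \<union> S" "y \<noteq> s" "(s, y) \<notin> ?E" by blast
    obtain v where v: "simplicial_in ?E (D \<union> S) v" "v \<noteq> s" "(s, v) \<notin> ?E"
      using IH[of s y] s by auto
    then have "v \<in> D" using S_clique[of s v] s by (auto simp: simplicial_in_def)
    then show ?thesis using lift v by blast
  next
    case S_univ: False
    \<comment> \<open>Now every vertex of \<open>S\<close> is adjacent to all others in
      \<open>D \<union> S\<close>, so a vertex found from a base \<open>x\<close> in
      \<open>D\<close>, being nonadjacent to \<open>x\<close>, cannot lie in
      \<open>S\<close>.\<close>
    show ?thesis
    proof (cases "\<exists>x\<in>D. \<exists>y\<in>D. y \<noteq> x \<and> (x, y) \<notin> ?E")
      case True
      then obtain x y where x: "x \<in> D" "y \<in> D" "y \<noteq> x" "(x, y) \<notin> ?E" by blast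
      obtain v where v: "simplicial_in ?E (D \<union> S) v" "v \<noteq> x" "(x, v) \<notin> ?E"
        using IH[of x y] x by (metis UnI1)
      have "(v, x) \<in> ?E" if "v \<in> S" using S_univ that x(1) v(2) by (metis UnI1)
      then have "v \<notin> S" using v(3) sym[of v x] by blast
      then have "v \<in> D" using v by (auto simp: simplicial_in_def)
      then show ?thesis using lift v by blast
    next
      case False
      have "(p, r) \<in> ?E" if pr: "p \<in> D \<union> S" "r \<in> D \<union> S" "p \<noteq> r" for p r
      proof -
        consider "p \<in> S" | "r \<in> S" | "p \<in> D" "r \<in> D" using pr by blast
        then show ?thesis
        proof cases
          case 1
          then show ?thesis using S_univ pr by metis
        next
          case 2
          then have "(r, p) \<in> ?E" using S_univ pr by metis
          then show ?thesis by (rule sym)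
        next
          case 3
          then show ?thesis using False pr by metis
        qed
      qed
      then have "simplicial_in ?E (D \<union> S) w"
        using wD unfolding simplicial_in_def by auto
      then show ?thesis using lift wD by blast
    qed
  qed
qed

lemma simplicial_exists:
  assumes "pair_graph G" "chordal G" "finite X" "X \<noteq> {}"
  shows "\<exists>v. simplicial_in (parcs G) X v"
proof (cases "\<exists>u\<in>X. \<exists>w\<in>X. w \<noteq> u \<and> (u, w) \<notin> parcs G")
  case True
  then show ?thesis using simplicial_nonneighbour[OF assms(1-3)] by blast
next
  case False
  moreover obtain v where "v \<in> X" using assms(4) by blast
  ultimately have "simplicial_in (parcs G) X v" unfolding simplicial_in_def by metis
  then show ?thesis ..
qed

section \<open>Decomposition of sparse semidefinite matrices\<close>

definition qform :: "'a set \<Rightarrow> ('a \<Rightarrow> 'a \<Rightarrow> real) \<Rightarrow> ('a \<Rightarrow> real) \<Rightarrow> real" where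
  "qform I P x = (\<Sum>\<alpha>\<in>I. \<Sum>\<beta>\<in>I. x \<alpha> * P \<alpha> \<beta> * x \<beta>)"

text \<open>Matrices are total functions here. Symmetry is required at all indices, so that it can
  be used without membership conditions; only the quadratic form sees \<open>I\<close>.\<close>

definition psd_on :: "'a set \<Rightarrow> ('a \<Rightarrow> 'a \<Rightarrow> real) \<Rightarrow> bool" where
  "psd_on I P \<longleftrightarrow> (\<forall>\<alpha> \<beta>. P \<alpha> \<beta> = P \<beta> \<alpha>) \<and> (\<forall>x. 0 \<le> qform I P x)"

lemma qform_add: "qform I (\<lambda>\<alpha> \<beta>. P \<alpha> \<beta> + Q \<alpha> \<beta>) x = qform I P x + qform I Q x"
  by (simp add: qform_def algebra_simps sum.distrib)

lemma qform_rank_one: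
  "qform I (\<lambda>\<alpha> \<beta>. c * (u \<alpha> * u \<beta>)) x = c * (\<Sum>\<alpha>\<in>I. u \<alpha> * x \<alpha>)\<^sup>2"
  by (simp add: qform_def power2_eq_square sum_product sum_distrib_left algebra_simps)

text \<open>Along one coordinate direction the form is a quadratic polynomial in \<open>t\<close>.
  Choosing \<open>t\<close> suitably yields both the vanishing of rows with zero pivot and the
  semidefiniteness of Schur complements.\<close>

lemma qform_shift:
  assumes "finite I" "a \<in> I" and sym: "\<And>\<alpha> \<beta>. P \<alpha> \<beta> = P \<beta> \<alpha>"
  shows "qform I P (\<lambda>\<alpha>. x \<alpha> + (if \<alpha> = a then t else 0)) =
    qform I P x + 2 * t * (\<Sum>\<beta>\<in>I. P a \<beta> * x \<beta>) + t\<^sup>2 * P a a"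
proof -
  let ?e = "\<lambda>\<alpha>. if \<alpha> = a then t else 0 :: real"
  have "qform I P (\<lambda>\<alpha>. x \<alpha> + ?e \<alpha>) =
      (\<Sum>\<alpha>\<in>I. \<Sum>\<beta>\<in>I. x \<alpha> * P \<alpha> \<beta> * x \<beta>) + (\<Sum>\<alpha>\<in>I. \<Sum>\<beta>\<in>I. x \<alpha> * P \<alpha> \<beta> * ?e \<beta>)
      + (\<Sum>\<alpha>\<in>I. ?e \<alpha> * (\<Sum>\<beta>\<in>I. P \<alpha> \<beta> * x \<beta>)) + (\<Sum>\<alpha>\<in>I. ?e \<alpha> * (\<Sum>\<beta>\<in>I. P \<alpha> \<beta> * ?e \<beta>))"
    unfolding qform_def sum_distrib_left sum.distrib[symmetric]
    by (intro sum.cong refl) (simp add: algebra_simps)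
  also have "(\<Sum>\<alpha>\<in>I. \<Sum>\<beta>\<in>I. x \<alpha> * P \<alpha> \<beta> * ?e \<beta>) = t * (\<Sum>\<beta>\<in>I. P a \<beta> * x \<beta>)"
    using assms(1,2) sym[of _ a]
    by (simp add: if_distrib[of "\<lambda>z. _ * z"] sum.delta' sum_distrib_left algebra_simps cong: if_cong)
  also have "(\<Sum>\<alpha>\<in>I. ?e \<alpha> * (\<Sum>\<beta>\<in>I. P \<alpha> \<beta> * x \<beta>)) = t * (\<Sum>\<beta>\<in>I. P a \<beta> * x \<beta>)"
    using assms(1,2) by (simp add: if_distrib[of "\<lambda>z. z * _"] sum.delta' cong: if_cong)
  also have "(\<Sum>\<alpha>\<in>I. ?e \<alpha> * (\<Sum>\<beta>\<in>I. P \<alpha> \<beta> * ?e \<beta>)) = t\<^sup>2 * P a a"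
    using assms(1,2)
    by (simp add: if_distrib[of "\<lambda>z. z * _"] if_distrib[of "\<lambda>z. _ * z"] sum.delta' power2_eq_square
        cong: if_cong)
  finally show ?thesis by (simp add: qform_def)
qed

lemma psd_on_diag_nonneg:
  assumes "finite I" "a \<in> I" "psd_on I P"
  shows "0 \<le> P a a"
proof -
  have "qform I P (\<lambda>\<alpha>. 0 + (if \<alpha> = a then 1 else 0)) = P a a"
    by (subst qform_shift) (use assms in \<open>auto simp: psd_on_def qform_def\<close>)
  then show ?thesis using assms by (metis psd_on_def)
qed

text \<open>With a zero diagonal entry the polynomial in \<open>t\<close> is affine, so it stays
  nonnegative only if its slope vanishes.\<close>

lemma psd_on_zero_diag:
  assumes "finite I" "a \<in> I" "b \<in> I" and P: "psd_on I P" and "P a a = 0"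
  shows "P a b = 0"
proof (rule ccontr)
  assume nz: "P a b \<noteq> 0"
  let ?x = "\<lambda>\<beta>. if \<beta> = b then 1 else 0 :: real"
  \<comment> \<open>The point at which the affine function takes the value -1.\<close>
  define t where "t = - (qform I P ?x + 1) / (2 * P a b)"
  have "qform I P (\<lambda>\<alpha>. ?x \<alpha> + (if \<alpha> = a then t else 0)) = qform I P ?x + 2 * t * P a b"
    by (subst qform_shift)
      (use assms in \<open>auto simp: psd_on_def if_distrib[of "\<lambda>z. _ * z"] sum.delta' cong: if_cong\<close>)
  also have "\<dots> = -1" using nz by (simp add: t_def field_simps)
  finally have "qform I P (\<lambda>\<alpha>. ?x \<alpha> + (if \<alpha> = a then t else 0)) < 0" by simp
  then show False using P unfolding psd_on_def by (meson not_less)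
qed

text \<open>The form of the complement at \<open>x\<close> is the minimum of the form of
  \<open>P\<close> over all changes of the coordinate \<open>a\<close>; the minimiser is
  \<open>- s / P a a\<close>.\<close>

lemma psd_on_schur_complement:
  assumes "finite I" "a \<in> I" and P: "psd_on I P" and pos: "0 < P a a"
  shows "psd_on I (\<lambda>\<alpha> \<beta>. P \<alpha> \<beta> + (- 1 / P a a) * (P a \<alpha> * P a \<beta>))"
  unfolding psd_on_def
proof (intro conjI allI)
  show "P \<alpha> \<beta> + - 1 / P a a * (P a \<alpha> * P a \<beta>) = P \<beta> \<alpha> + - 1 / P a a * (P a \<beta> * P a \<alpha>)" for \<alpha> \<beta>
    using P by (simp add: psd_on_def mult.commute)
  fix x
  define s where "s = (\<Sum>\<beta>\<in>I. P a \<beta> * x \<beta>)"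
  have "0 \<le> qform I P (\<lambda>\<alpha>. x \<alpha> + (if \<alpha> = a then - s / P a a else 0))"
    using P by (simp add: psd_on_def)
  also have "\<dots> = qform I P x + 2 * (- s / P a a) * s + (- s / P a a)\<^sup>2 * P a a"
    unfolding s_def by (subst qform_shift) (use assms in \<open>auto simp: psd_on_def\<close>)
  also have "\<dots> = qform I P x + (- 1 / P a a) * s\<^sup>2"
    using pos by (simp add: field_simps power2_eq_square)
  also have "\<dots> = qform I (\<lambda>\<alpha> \<beta>. P \<alpha> \<beta> + (- 1 / P a a) * (P a \<alpha> * P a \<beta>)) x"
    unfolding qform_add qform_rank_one s_def ..
  finally show "0 \<le> qform I (\<lambda>\<alpha> \<beta>. P \<alpha> \<beta> + (- 1 / P a a) * (P a \<alpha> * P a \<beta>)) x" .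
qed

text \<open>
  Agler's decomposition, by Cholesky elimination along a perfect elimination order: the pivot
  index belongs to a simplicial node, so the rank-one term is supported on a clique and
  subtracting it creates no fill-in.
\<close>

lemma psd_chordal_decomposition:
  fixes P :: "nat \<Rightarrow> nat \<Rightarrow> real" and \<nu> :: "nat \<Rightarrow> nat"
  assumes G: "pair_graph G" and ch: "chordal G" and I: "finite I" and K: "finite K"
    and cover: "\<And>X. is_clique G X \<Longrightarrow> \<exists>k\<in>K. X \<subseteq> C k"
    and "U \<subseteq> I" "\<nu> ` U \<subseteq> pverts G" "psd_on I P"
    and "\<And>\<alpha> \<beta>. P \<alpha> \<beta> \<noteq> 0 \<Longrightarrow> \<alpha> \<in> U \<and> \<beta> \<in> U \<and> (\<nu> \<alpha> = \<nu> \<beta> \<or> (\<nu> \<alpha>, \<nu> \<beta>) \<in> parcs G)"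
  shows "\<exists>W. (\<forall>k\<in>K. psd_on I (W k) \<and> (\<forall>\<alpha> \<beta>. W k \<alpha> \<beta> \<noteq> 0 \<longrightarrow> \<nu> \<alpha> \<in> C k \<and> \<nu> \<beta> \<in> C k)) \<and>
    (\<forall>\<alpha> \<beta>. P \<alpha> \<beta> = (\<Sum>k\<in>K. W k \<alpha> \<beta>))"
  using assms(6-)
proof (induction "card U" arbitrary: U P)
  case 0
  then have "U = {}" using I by (auto dest: finite_subset)
  then have "P \<alpha> \<beta> = 0" for \<alpha> \<beta> using 0 by blast
  then show ?case by (intro exI[of _ "\<lambda>_ _ _. 0"]) (auto simp: psd_on_def qform_def)
next
  case (Suc m)
  note psd = Suc.prems(3) and sparse = Suc.prems(4)
  have symP: "P \<alpha> \<beta> = P \<beta> \<alpha>" for \<alpha> \<beta> using psd by (simp add: psd_on_def)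
  have finU: "finite U" using Suc.prems(1) I finite_subset by blast
  have "U \<noteq> {}" using Suc.hyps(2) by auto
  then obtain v where v: "simplicial_in (parcs G) (\<nu> ` U) v"
    using simplicial_exists[OF G ch, of "\<nu> ` U"] finU by auto
  \<comment> \<open>Any index of the simplicial node will do; other indices of that node stay in
    \<open>U\<close> for later steps.\<close>
  then obtain a where a: "a \<in> U" "\<nu> a = v" by (auto simp: simplicial_in_def)
  have aI: "a \<in> I" using a Suc.prems by blast
  have U': "m = card (U - {a})" "U - {a} \<subseteq> I" "\<nu> ` (U - {a}) \<subseteq> pverts G"
    using Suc.hyps(2) Suc.prems a finU by auto
  show ?case
  proof (cases "P a a = 0")
    case True
    have a0: "P a \<beta> = 0" for \<beta>
      using psd_on_zero_diag[OF I aI _ psd True, of \<beta>] sparse[of a \<beta>] Suc.prems(1) by blast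
    have "\<alpha> \<in> U - {a} \<and> \<beta> \<in> U - {a} \<and> (\<nu> \<alpha> = \<nu> \<beta> \<or> (\<nu> \<alpha>, \<nu> \<beta>) \<in> parcs G)"
      if "P \<alpha> \<beta> \<noteq> 0" for \<alpha> \<beta>
      using sparse[OF that] that a0 symP[of \<alpha> \<beta>] by auto
    then show ?thesis by (rule Suc.hyps(1)[OF U' psd])
  next
    case False
    then have pos: "0 < P a a" using psd_on_diag_nonneg[OF I aI psd] by simp
    define Q where "Q \<alpha> \<beta> = P \<alpha> \<beta> + (- 1 / P a a) * (P a \<alpha> * P a \<beta>)" for \<alpha> \<beta>
    have Q_psd: "psd_on I Q"
      unfolding Q_def by (rule psd_on_schur_complement[OF I aI psd pos])
    \<comment> \<open>The support of the pivot row. Its nodes are \<open>v\<close> and neighbours of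
      \<open>v\<close> in the remaining graph, hence form a clique.\<close>
    define T where "T = {\<beta>. P a \<beta> \<noteq> 0}"
    have adj: "\<nu> \<alpha> = \<nu> \<beta> \<or> (\<nu> \<alpha>, \<nu> \<beta>) \<in> parcs G" if "\<alpha> \<in> T" "\<beta> \<in> T" for \<alpha> \<beta>
    proof -
      have "\<alpha> \<in> U" "\<beta> \<in> U" "v = \<nu> \<alpha> \<or> (v, \<nu> \<alpha>) \<in> parcs G" "v = \<nu> \<beta> \<or> (v, \<nu> \<beta>) \<in> parcs G"
        using sparse[of a \<alpha>] sparse[of a \<beta>] that a(2) by (auto simp: T_def)
      then show ?thesis
        using v pair_graph_sym[OF G, of v "\<nu> \<alpha>"] unfolding simplicial_in_def by (metis imageI)
    qed
    have TU: "T \<subseteq> U" using sparse by (auto simp: T_def)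
    have "is_clique G (\<nu> ` T)"
      unfolding is_clique_def
    proof (intro conjI)
      show "\<nu> ` T \<noteq> {}" using pos by (auto simp: T_def intro!: exI[of _ a])
      show "\<nu> ` T \<subseteq> pverts G" using Suc.prems(2) TU by blast
    qed (use adj in auto)
    then obtain k where k: "k \<in> K" "\<nu> ` T \<subseteq> C k" using cover by blast
    \<comment> \<open>No fill-in: the subtraction can create a nonzero entry only between two
      indices of \<open>T\<close>, whose nodes are equal or adjacent already. Row and column
      \<open>a\<close> cancel.\<close>
    have "\<alpha> \<in> U - {a} \<and> \<beta> \<in> U - {a} \<and> (\<nu> \<alpha> = \<nu> \<beta> \<or> (\<nu> \<alpha>, \<nu> \<beta>) \<in> parcs G)"
      if nz: "Q \<alpha> \<beta> \<noteq> 0" for \<alpha> \<beta>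
    proof -
      have "\<alpha> \<noteq> a" using nz pos by (auto simp: Q_def)
      moreover have "\<beta> \<noteq> a" using nz pos symP[of \<alpha> a] by (auto simp: Q_def)
      moreover have "P \<alpha> \<beta> \<noteq> 0 \<or> \<alpha> \<in> T \<and> \<beta> \<in> T" using nz by (auto simp: Q_def T_def)
      ultimately show ?thesis using sparse[of \<alpha> \<beta>] adj[of \<alpha> \<beta>] TU by blast
    qed
    from Suc.hyps(1)[OF U' Q_psd this] obtain W where
      W: "\<And>k. k \<in> K \<Longrightarrow> psd_on I (W k)"
      "\<And>k \<alpha> \<beta>. k \<in> K \<Longrightarrow> W k \<alpha> \<beta> \<noteq> 0 \<Longrightarrow> \<nu> \<alpha> \<in> C k \<and> \<nu> \<beta> \<in> C k"
      and WQ: "\<And>\<alpha> \<beta>. Q \<alpha> \<beta> = (\<Sum>k\<in>K. W k \<alpha> \<beta>)"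
      by blast
    \<comment> \<open>The subtracted term is returned to a single clique \<open>k\<close> that
      contains its support.\<close>
    let ?R = "\<lambda>\<alpha> \<beta>. (1 / P a a) * (P a \<alpha> * P a \<beta>)"
    define W' where "W' l = (if l = k then (\<lambda>\<alpha> \<beta>. W k \<alpha> \<beta> + ?R \<alpha> \<beta>) else W l)" for l
    have "psd_on I (W' l)" if "l \<in> K" for l
    proof (cases "l = k")
      case True
      have "0 \<le> qform I ?R x" for x
        unfolding qform_rank_one using pos by simp
      then have "psd_on I (\<lambda>\<alpha> \<beta>. W k \<alpha> \<beta> + ?R \<alpha> \<beta>)"
        using W(1)[OF k(1)] unfolding psd_on_def qform_add by (simp add: mult.commute)
      then show ?thesis by (simp add: W'_def True)
    qed (use W(1) that in \<open>simp add: W'_def\<close>)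
    moreover have "\<nu> \<alpha> \<in> C l \<and> \<nu> \<beta> \<in> C l" if "l \<in> K" "W' l \<alpha> \<beta> \<noteq> 0" for l \<alpha> \<beta>
    proof (cases "l = k \<and> \<alpha> \<in> T \<and> \<beta> \<in> T")
      case True
      then show ?thesis using k by blast
    next
      case False
      then show ?thesis using W(2)[OF that(1), of \<alpha> \<beta>] that by (auto simp: W'_def T_def split: if_splits)
    qed
    moreover have "P \<alpha> \<beta> = (\<Sum>l\<in>K. W' l \<alpha> \<beta>)" for \<alpha> \<beta>
    proof -
      have "(\<Sum>l\<in>K. W' l \<alpha> \<beta>) = (\<Sum>l\<in>K. W l \<alpha> \<beta> + (if l = k then ?R \<alpha> \<beta> else 0))"
        by (intro sum.cong) (auto simp: W'_def)
      also have "\<dots> = Q \<alpha> \<beta> + ?R \<alpha> \<beta>" using K k(1) by (simp add: sum.distrib WQ)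
      also have "\<dots> = P \<alpha> \<beta>" by (simp add: Q_def)
      finally show ?thesis ..
    qed
    ultimately show ?thesis by blast
  qed
qed

section \<open>Definite matrices\<close>

lemma scalar_prod_self_nonneg: "0 \<le> v \<bullet> (v :: real vec)"
  by (auto simp: scalar_prod_def intro: sum_nonneg)

lemma scalar_prod_self_pos:
  assumes "v \<in> carrier_vec n" "v \<noteq> 0\<^sub>v n"
  shows "0 < v \<bullet> (v :: real vec)"
proof -
  obtain i where "i < n" "v $ i \<noteq> 0" using assms by (metis carrier_vecD eq_vecI index_zero_vec)
  then have "0 < v $ i * v $ i" by (auto simp: zero_less_mult_iff linorder_neq_iff)
  then show ?thesis unfolding scalar_prod_def
    by (intro sum_pos2[of _ i]) (use assms(1) \<open>i < n\<close> in auto)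
qed

lemma transpose_move:
  fixes X :: "real mat"
  assumes "X \<in> carrier_mat m n" "u \<in> carrier_vec m" "v \<in> carrier_vec n"
  shows "u \<bullet> (X *\<^sub>v v) = (transpose_mat X *\<^sub>v u) \<bullet> v"
  using transpose_vec_mult_scalar[OF assms(1,3,2)] by simp

lemma scalar_prod_mat_vec_sum:
  assumes "X \<in> carrier_mat m n" "u \<in> carrier_vec m" "v \<in> carrier_vec n"
  shows "u \<bullet> (X *\<^sub>v v) = (\<Sum>i<m. \<Sum>j<n. u $ i * X $$ (i, j) * v $ j)"
  using assms
  by (auto simp: scalar_prod_def sum_distrib_left atLeast0LessThan mult.assoc intro!: sum.cong)

text \<open>Each product of two coordinates is at most \<open>v \<bullet> v\<close> in absolute
  value, so the sum of the absolute values of all entries is a possible constant.\<close>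

lemma quadratic_form_bound:
  fixes X :: "real mat"
  assumes X: "X \<in> carrier_mat m m"
  obtains b where "0 \<le> b" "\<And>v. v \<in> carrier_vec m \<Longrightarrow> \<bar>v \<bullet> (X *\<^sub>v v)\<bar> \<le> b * (v \<bullet> v)"
proof (rule that)
  let ?b = "\<Sum>i<m. \<Sum>j<m. \<bar>X $$ (i, j)\<bar>"
  show "0 \<le> ?b" by (intro sum_nonneg) auto
  fix v :: "real vec" assume v: "v \<in> carrier_vec m"
  have le: "(v $ i)\<^sup>2 \<le> v \<bullet> v" if "i < m" for i
  proof -
    have "v $ i * v $ i \<le> (\<Sum>i\<in>{0..<m}. v $ i * v $ i)"
      by (intro member_le_sum[of i "{0..<m}" "\<lambda>i. v $ i * v $ i"]) (use that in auto)
    also have "\<dots> = v \<bullet> v" using v by (simp add: scalar_prod_def)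
    finally show ?thesis by (simp add: power2_eq_square)
  qed
  have "\<bar>v $ i * v $ j\<bar> \<le> v \<bullet> v" if "i < m" "j < m" for i j
  proof -
    have "0 \<le> (\<bar>v $ i\<bar> - \<bar>v $ j\<bar>)\<^sup>2" by simp
    then have "2 * \<bar>v $ i * v $ j\<bar> \<le> (v $ i)\<^sup>2 + (v $ j)\<^sup>2"
      by (simp add: power2_diff abs_mult)
    then show ?thesis using le[OF that(1)] le[OF that(2)] by simp
  qed
  then have "\<bar>X $$ (i, j)\<bar> * \<bar>v $ i * v $ j\<bar> \<le> \<bar>X $$ (i, j)\<bar> * (v \<bullet> v)" if "i < m" "j < m" for i j
    using that by (intro mult_left_mono) auto
  then have "\<bar>v $ i * X $$ (i, j) * v $ j\<bar> \<le> \<bar>X $$ (i, j)\<bar> * (v \<bullet> v)" if "i < m" "j < m" for i j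
    using that by (simp add: abs_mult ac_simps)
  then have "(\<Sum>i<m. \<Sum>j<m. \<bar>v $ i * X $$ (i, j) * v $ j\<bar>) \<le> ?b * (v \<bullet> v)"
    unfolding sum_distrib_right by (intro sum_mono) auto
  moreover have "\<bar>\<Sum>i<m. \<Sum>j<m. v $ i * X $$ (i, j) * v $ j\<bar>
      \<le> (\<Sum>i<m. \<Sum>j<m. \<bar>v $ i * X $$ (i, j) * v $ j\<bar>)"
    by (rule order_trans[OF sum_abs]) (intro sum_mono sum_abs)
  ultimately show "\<bar>v \<bullet> (X *\<^sub>v v)\<bar> \<le> ?b * (v \<bullet> v)"
    using scalar_prod_mat_vec_sum[OF X v v] by simp
qed

section \<open>Positive definite matrices: inverses and coercivity\<close>

lemma pos_defI:
  assumes "X \<in> carrier_mat m m" "transpose_mat X = X"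
    and "\<And>v. v \<in> carrier_vec m \<Longrightarrow> v \<noteq> 0\<^sub>v m \<Longrightarrow> 0 < v \<bullet> (X *\<^sub>v v)"
  shows "pos_def X"
  using assms by (auto simp: pos_def_def)

lemma pos_defD:
  assumes "pos_def X" "X \<in> carrier_mat m m"
  shows "transpose_mat X = X"
    and "v \<in> carrier_vec m \<Longrightarrow> v \<noteq> 0\<^sub>v m \<Longrightarrow> 0 < v \<bullet> (X *\<^sub>v v)"
  using assms by (auto simp: pos_def_def)

lemma neg_def_iff:
  assumes "X \<in> carrier_mat m m"
  shows "neg_def X \<longleftrightarrow> transpose_mat X = X \<and>
    (\<forall>v\<in>carrier_vec m. v \<noteq> 0\<^sub>v m \<longrightarrow> v \<bullet> (X *\<^sub>v v) < 0)"
  using assms by (auto simp: neg_def_def)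

text \<open>Inverses are unique, so the one returned by Gauss-Jordan elimination is any two-sided
  inverse at hand. This is how \<open>minv\<close> is evaluated.\<close>

lemma minv_eq:
  assumes "X \<in> carrier_mat m m" "Y \<in> carrier_mat m m" "X * Y = 1\<^sub>m m" "Y * X = 1\<^sub>m m"
  shows "minv X = Y"
proof -
  have "X \<in> Units (ring_mat TYPE(real) m ())"
    using assms unfolding Units_def ring_mat_def by auto
  then obtain B where "mat_inverse X = Some B" using mat_inverse(1)[OF assms(1), of "()"] by (cases "mat_inverse X") auto
  moreover from mat_inverse(2)[OF assms(1) this]
  have B: "B * X = 1\<^sub>m m" "B \<in> carrier_mat m m" by auto
  have "B = B * (X * Y)" using assms B by simp
  also have "\<dots> = (B * X) * Y" by (rule assoc_mult_mat[OF B(2) assms(1,2), symmetric])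
  also have "\<dots> = Y" using B assms by simp
  finally show ?thesis using \<open>mat_inverse X = Some B\<close> by (simp add: minv_def)
qed

text \<open>A kernel vector would make the form vanish, so \<open>X\<close> is invertible. The
  transpose of the inverse is again an inverse, hence equal to it, and its form at \<open>v\<close>
  is the form of \<open>X\<close> at \<open>Y *\<^sub>v v\<close>.\<close>

lemma pos_def_inverse:
  assumes X: "X \<in> carrier_mat m m" and pd: "pos_def X"
  obtains Y where "Y \<in> carrier_mat m m" "X * Y = 1\<^sub>m m" "Y * X = 1\<^sub>m m" "pos_def Y"
proof -
  have "det X \<noteq> 0"
  proof
    assume "det X = 0"
    then obtain v where v: "v \<in> carrier_vec m" "v \<noteq> 0\<^sub>v m" "X *\<^sub>v v = 0\<^sub>v m"
      using det_0_iff_vec_prod_zero[OF X] by blast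
    then show False using pos_defD(2)[OF pd X v(1,2)] by simp
  qed
  then have "X \<in> Units (ring_mat TYPE(real) m ())" by (rule det_non_zero_imp_unit[OF X])
  then obtain Y where Y: "Y \<in> carrier_mat m m" "X * Y = 1\<^sub>m m" "Y * X = 1\<^sub>m m"
    unfolding Units_def ring_mat_def by auto
  have tY: "transpose_mat Y \<in> carrier_mat m m" using Y by simp
  have XT: "transpose_mat X = X" by (rule pos_defD(1)[OF pd X])
  have "transpose_mat Y * X = 1\<^sub>m m"
    using transpose_mult[OF X Y(1)] XT Y(2) by simp
  moreover have "X * transpose_mat Y = 1\<^sub>m m"
    using transpose_mult[OF Y(1) X] XT Y(3) by simp
  ultimately have "minv X = transpose_mat Y" using minv_eq[OF X tY] by simp
  then have YT: "transpose_mat Y = Y" using minv_eq[OF X Y] by simp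
  have "pos_def Y"
  proof (rule pos_defI[OF Y(1) YT])
    fix v :: "real vec" assume v: "v \<in> carrier_vec m" "v \<noteq> 0\<^sub>v m"
    define y where "y = Y *\<^sub>v v"
    have y: "y \<in> carrier_vec m" using Y v by (simp add: y_def)
    have Xy: "X *\<^sub>v y = v" using assoc_mult_mat_vec[OF X Y(1) v(1)] Y v by (simp add: y_def)
    have "y \<noteq> 0\<^sub>v m" using Xy X v by auto
    then have "0 < y \<bullet> (X *\<^sub>v y)" by (rule pos_defD(2)[OF pd X y])
    then show "0 < v \<bullet> (Y *\<^sub>v v)" unfolding Xy using comm_scalar_prod[OF y v(1)] by (simp add: y_def)
  qed
  then show thesis using that Y by blast
qed

lemma quadratic_form_shift:
  assumes X: "X \<in> carrier_mat m m" "transpose_mat X = X"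
    and u: "u \<in> carrier_vec m" and v: "v \<in> carrier_vec m"
  shows "(u + t \<cdot>\<^sub>v v) \<bullet> (X *\<^sub>v (u + t \<cdot>\<^sub>v v)) =
    u \<bullet> (X *\<^sub>v u) + 2 * t * (u \<bullet> (X *\<^sub>v v)) + t\<^sup>2 * (v \<bullet> (X *\<^sub>v (v :: real vec)))"
proof -
  have "v \<bullet> (X *\<^sub>v u) = (X *\<^sub>v v) \<bullet> u"
    using transpose_move[OF X(1) v u] unfolding X(2) .
  also have "\<dots> = u \<bullet> (X *\<^sub>v v)"
    by (rule comm_scalar_prod[of _ m]) (use X u v in auto)
  finally have "v \<bullet> (X *\<^sub>v u) = u \<bullet> (X *\<^sub>v v)" .
  moreover have "X *\<^sub>v u \<in> carrier_vec m" "X *\<^sub>v v \<in> carrier_vec m" using X u v by auto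
  ultimately show ?thesis using X u v
    by (simp add: mult_add_distrib_mat_vec[OF X(1)] mult_mat_vec[OF X(1)] power2_eq_square
        add_scalar_prod_distrib[where n = m] scalar_prod_add_distrib[where n = m] algebra_simps)
qed

text \<open>
  Evaluating the form of \<open>X\<close> at \<open>v - t X\<^sup>-\<^sup>1 v\<close> replaces compactness of the sphere.
\<close>

lemma pos_def_coercive:
  assumes X: "X \<in> carrier_mat m m" and pd: "pos_def X"
  obtains c where "0 < c" "\<And>v. v \<in> carrier_vec m \<Longrightarrow> c * (v \<bullet> v) \<le> v \<bullet> (X *\<^sub>v v)"
proof -
  obtain Y where Y: "Y \<in> carrier_mat m m" "X * Y = 1\<^sub>m m" "Y * X = 1\<^sub>m m" "pos_def Y"
    using pos_def_inverse[OF assms] .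
  obtain b where b: "0 \<le> b" "\<And>v. v \<in> carrier_vec m \<Longrightarrow> \<bar>v \<bullet> (Y *\<^sub>v v)\<bar> \<le> b * (v \<bullet> v)"
    using quadratic_form_bound[OF Y(1)] by blast
  show thesis
  proof (rule that[of "1 / (b + 1)"])
    show "0 < 1 / (b + 1)" using b by simp
    fix v :: "real vec" assume v: "v \<in> carrier_vec m"
    define y where "y = Y *\<^sub>v v"
    have y: "y \<in> carrier_vec m" using Y v by (simp add: y_def)
    have Xy: "X *\<^sub>v y = v" using assoc_mult_mat_vec[OF X Y(1) v(1)] Y v by (simp add: y_def)
    \<comment> \<open>What matters is \<open>t * b \<le> 1\<close>: the quadratic term then consumes
      at most one of the two copies of \<open>t * (v \<bullet> v)\<close> in the linear term. Adding
      1 covers \<open>b = 0\<close>.\<close>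
    define t where "t = 1 / (b + 1)"
    have t: "0 < t" "t * b \<le> 1" using b by (auto simp: t_def divide_simps)
    define z where "z = v + (- t) \<cdot>\<^sub>v y"
    have z: "z \<in> carrier_vec m" using v y by (simp add: z_def)
    have "0 \<le> z \<bullet> (X *\<^sub>v z)"
      by (cases "z = 0\<^sub>v m") (use pos_defD(2)[OF pd X z] X in \<open>auto simp: less_imp_le\<close>)
    also have "\<dots> = v \<bullet> (X *\<^sub>v v) - 2 * t * (v \<bullet> v) + t\<^sup>2 * (y \<bullet> v)"
      unfolding z_def quadratic_form_shift[OF X pos_defD(1)[OF pd X] v y] Xy by simp
    also have "y \<bullet> v \<le> b * (v \<bullet> v)" using b(2)[OF v] comm_scalar_prod[OF v y] by (simp add: y_def)
    then have "t\<^sup>2 * (y \<bullet> v) \<le> t\<^sup>2 * (b * (v \<bullet> v))" by (rule mult_left_mono) simp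
    also have "\<dots> = t * ((t * b) * (v \<bullet> v))" by (simp add: power2_eq_square ac_simps)
    also have "\<dots> \<le> t * (1 * (v \<bullet> v))"
      using t by (intro mult_left_mono mult_right_mono scalar_prod_self_nonneg) auto
    finally show "1 / (b + 1) * (v \<bullet> v) \<le> v \<bullet> (X *\<^sub>v v)" by (simp add: t_def)
  qed
qed

text \<open>Split \<open>w = e + u\<close> into \<open>e = E *\<^sub>v (F *\<^sub>v w)\<close> and
  \<open>u = M *\<^sub>v w\<close>. The form is coercive in the coordinates \<open>x\<close> of
  \<open>e\<close>, the cross term is absorbed half by this and half by a multiple of
  \<open>u \<bullet> u\<close>, and \<open>\<rho>\<close> pays for everything in \<open>u\<close>,
  since \<open>w \<bullet> (M *\<^sub>v w) = u \<bullet> u\<close>.\<close>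

lemma finsler:
  fixes E F S :: "real mat"
  assumes E: "E \<in> carrier_mat m n" and F: "F \<in> carrier_mat n m" and FE: "F * E = 1\<^sub>m n"
    and S: "S \<in> carrier_mat m m"
    and M: "M = 1\<^sub>m m - E * F" and MT: "transpose_mat M = M"
    and pos: "\<And>x. x \<in> carrier_vec n \<Longrightarrow> x \<noteq> 0\<^sub>v n \<Longrightarrow> 0 < (E *\<^sub>v x) \<bullet> (S *\<^sub>v (E *\<^sub>v x))"
  shows "\<exists>\<rho>. \<forall>w\<in>carrier_vec m. w \<noteq> 0\<^sub>v m \<longrightarrow> 0 < w \<bullet> (S *\<^sub>v w) + \<rho> * (w \<bullet> (M *\<^sub>v w))"
proof -
  \<comment> \<open>In the application \<open>S\<close> is not symmetric, so the two cross terms are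
    collected: together they are \<open>u \<bullet> (Y *\<^sub>v x)\<close>.\<close>
  define Y where "Y = (S + transpose_mat S) * E"
  have Y: "Y \<in> carrier_mat m n" unfolding Y_def by (rule mult_carrier_mat[of _ m m]) (use S E in auto)
  \<comment> \<open>The form of \<open>T\<close> is twice that of \<open>S\<close> on the range of
    \<open>E\<close>; hence the constant \<open>c / 2\<close> further down.\<close>
  define T where "T = transpose_mat E * Y"
  have T: "T \<in> carrier_mat n n" using E Y by (simp add: T_def)
  have SS: "u \<bullet> ((S + transpose_mat S) *\<^sub>v v) = u \<bullet> (S *\<^sub>v v) + v \<bullet> (S *\<^sub>v u)"
    if "u \<in> carrier_vec m" "v \<in> carrier_vec m" for u v
  proof -
    have "u \<bullet> (transpose_mat S *\<^sub>v v) = v \<bullet> (S *\<^sub>v u)"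
      using transpose_move[OF S that(2,1)] comm_scalar_prod[of u m "transpose_mat S *\<^sub>v v"] S that by simp
    then show ?thesis
      using S that by (simp add: add_mult_distrib_mat_vec[OF S] scalar_prod_add_distrib[where n = m])
  qed
  have TT: "transpose_mat T = T"
  proof -
    have "transpose_mat T = transpose_mat Y * E"
      using transpose_mult[of "transpose_mat E" n m Y n] E Y by (simp add: T_def)
    also have "transpose_mat Y = transpose_mat E * (S + transpose_mat S)"
      using transpose_mult[of "S + transpose_mat S" m m E n] E S
        transpose_add[OF S, of "transpose_mat S"] comm_add_mat[OF S, of "transpose_mat S"]
      by (simp add: Y_def)
    also have "\<dots> * E = T"
      unfolding T_def Y_def by (rule assoc_mult_mat[of _ n m _ m _ n]) (use E S in auto)
    finally show ?thesis .
  qed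
  have Ex: "E *\<^sub>v x \<in> carrier_vec m" if "x \<in> carrier_vec n" for x using E that by simp
  have T_form: "x \<bullet> (T *\<^sub>v x) = 2 * ((E *\<^sub>v x) \<bullet> (S *\<^sub>v (E *\<^sub>v x)))" if x: "x \<in> carrier_vec n" for x
  proof -
    have Yx: "Y *\<^sub>v x = (S + transpose_mat S) *\<^sub>v (E *\<^sub>v x)"
      unfolding Y_def by (rule assoc_mult_mat_vec[of _ m m]) (use S E x in auto)
    have "T *\<^sub>v x = transpose_mat E *\<^sub>v (Y *\<^sub>v x)"
      unfolding T_def by (rule assoc_mult_mat_vec[of _ n m]) (use Y E x in auto)
    then have "x \<bullet> (T *\<^sub>v x) = (E *\<^sub>v x) \<bullet> (Y *\<^sub>v x)"
      using transpose_move[of "transpose_mat E" n m x "Y *\<^sub>v x"] E x Y by simp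
    then show ?thesis unfolding Yx using SS[OF Ex[OF x] Ex[OF x]] by simp
  qed
  have "pos_def T"
    by (rule pos_defI[OF T TT]) (simp add: T_form pos)
  then obtain c where c: "0 < c" "\<And>x. x \<in> carrier_vec n \<Longrightarrow> c * (x \<bullet> x) \<le> x \<bullet> (T *\<^sub>v x)"
    using pos_def_coercive[OF T] by blast
  obtain b1 where b1: "0 \<le> b1"
    "\<And>u. u \<in> carrier_vec m \<Longrightarrow> \<bar>u \<bullet> ((Y * transpose_mat Y) *\<^sub>v u)\<bar> \<le> b1 * (u \<bullet> u)"
    by (rule quadratic_form_bound[of "Y * transpose_mat Y" m]) (use Y in auto)
  obtain b2 where b2: "0 \<le> b2" "\<And>u. u \<in> carrier_vec m \<Longrightarrow> \<bar>u \<bullet> (S *\<^sub>v u)\<bar> \<le> b2 * (u \<bullet> u)"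
    using quadratic_form_bound[OF S] by blast
  \<comment> \<open>\<open>b1 / c\<close> covers the cost of absorbing the cross term,
    \<open>b2\<close> the form of \<open>S\<close> at \<open>u\<close>, and 1 leaves a surplus
    \<open>u \<bullet> u\<close>.\<close>
  define \<rho> where "\<rho> = b1 / c + b2 + 1"
  have M_carr: "M \<in> carrier_mat m m" using E F by (auto simp: M)
  have "0 < w \<bullet> (S *\<^sub>v w) + \<rho> * (w \<bullet> (M *\<^sub>v w))" if w: "w \<in> carrier_vec m" "w \<noteq> 0\<^sub>v m" for w
  proof -
    define x where "x = F *\<^sub>v w"
    define e where "e = E *\<^sub>v x"
    define u where "u = M *\<^sub>v w"
    have x: "x \<in> carrier_vec n" using F w by (simp add: x_def)
    have e: "e \<in> carrier_vec m" using Ex x by (simp add: e_def)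
    have u: "u \<in> carrier_vec m" using M_carr w by (simp add: u_def)
    have Mv: "M *\<^sub>v v = v - E *\<^sub>v (F *\<^sub>v v)" if "v \<in> carrier_vec m" for v
      using that E F unfolding M
      by (simp add: minus_mult_distrib_mat_vec[where nr = m and nc = m] assoc_mult_mat_vec[OF E F])
    have u_eq: "u = w - e" unfolding u_def Mv[OF w(1)] e_def x_def ..
    then have w_eq: "w = e + u" using w e by auto
    have "F *\<^sub>v e = x" unfolding e_def
      using assoc_mult_mat_vec[OF F E x] FE x by simp
    then have "F *\<^sub>v u = 0\<^sub>v n"
      unfolding u_eq using mult_minus_distrib_mat_vec[OF F w(1) e] x by (simp add: x_def)
    then have "M *\<^sub>v u = u" using Mv[OF u] E u by auto
    then have wMw: "w \<bullet> (M *\<^sub>v w) = u \<bullet> u"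
      using transpose_move[OF M_carr w(1) u] MT by (simp add: u_def)
    define a where "a = transpose_mat Y *\<^sub>v u"
    have a: "a \<in> carrier_vec n" using Y u by (simp add: a_def)
    have "a \<bullet> a = u \<bullet> (Y *\<^sub>v a)" using transpose_move[OF Y u a] by (simp add: a_def)
    also have "Y *\<^sub>v a = (Y * transpose_mat Y) *\<^sub>v u" using Y u by (simp add: a_def)
    finally have aa: "a \<bullet> a \<le> b1 * (u \<bullet> u)" using b1(2)[OF u] by linarith
    have "u \<bullet> (S *\<^sub>v e) + e \<bullet> (S *\<^sub>v u) = u \<bullet> (Y *\<^sub>v x)"
    proof -
      have "Y *\<^sub>v x = (S + transpose_mat S) *\<^sub>v e"
        unfolding Y_def e_def by (rule assoc_mult_mat_vec[of _ m m]) (use S E x in auto)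
      then show ?thesis using SS[OF u e] by simp
    qed
    also have "\<dots> = a \<bullet> x" using transpose_move[OF Y u x] by (simp add: a_def)
    finally have cross: "u \<bullet> (S *\<^sub>v e) + e \<bullet> (S *\<^sub>v u) = a \<bullet> x" .
    \<comment> \<open>Completing the square, weighted so that the cross term uses up only
      \<open>c / 4\<close> of the available \<open>c / 2\<close>.\<close>
    have "0 \<le> (a + (c / 2) \<cdot>\<^sub>v x) \<bullet> (a + (c / 2) \<cdot>\<^sub>v x)" by (rule scalar_prod_self_nonneg)
    also have "\<dots> = a \<bullet> a + c * (a \<bullet> x) + (c / 2)\<^sup>2 * (x \<bullet> x)"
      using quadratic_form_shift[of "1\<^sub>m n" n a x "c / 2"] a x by simp
    also have "\<dots> = c * (a \<bullet> a / c + a \<bullet> x + c / 4 * (x \<bullet> x))"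
      using c by (simp add: field_simps power2_eq_square)
    finally have am_gm: "0 \<le> a \<bullet> a / c + a \<bullet> x + c / 4 * (x \<bullet> x)"
      using c(1) by (simp add: zero_le_mult_iff)
    have "a \<bullet> a / c \<le> b1 / c * (u \<bullet> u)" using aa c(1) by (simp add: divide_right_mono)
    moreover have "c / 2 * (x \<bullet> x) \<le> e \<bullet> (S *\<^sub>v e)"
      using c(2)[OF x] T_form[OF x] by (simp add: e_def)
    moreover have "- (b2 * (u \<bullet> u)) \<le> u \<bullet> (S *\<^sub>v u)" using b2(2)[OF u] by linarith
    moreover have "w \<bullet> (S *\<^sub>v w) = e \<bullet> (S *\<^sub>v e) + a \<bullet> x + u \<bullet> (S *\<^sub>v u)"
      unfolding w_eq cross[symmetric] using S e u
      by (simp add: mult_add_distrib_mat_vec[OF S] add_scalar_prod_distrib[where n = m]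
          scalar_prod_add_distrib[where n = m])
    moreover have "\<rho> * (u \<bullet> u) = b1 / c * (u \<bullet> u) + b2 * (u \<bullet> u) + u \<bullet> u"
      unfolding \<rho>_def by (simp only: distrib_right mult_1)
    ultimately have ge: "c / 4 * (x \<bullet> x) + u \<bullet> u \<le> w \<bullet> (S *\<^sub>v w) + \<rho> * (w \<bullet> (M *\<^sub>v w))"
      using am_gm unfolding wMw by linarith
    have "x \<noteq> 0\<^sub>v n \<or> u \<noteq> 0\<^sub>v m" using w w_eq E by (auto simp: e_def)
    then have "0 < c / 4 * (x \<bullet> x) + u \<bullet> u"
    proof
      assume "x \<noteq> 0\<^sub>v n"
      then have "0 < c / 4 * (x \<bullet> x)" using scalar_prod_self_pos[OF x] c by simp
      then show ?thesis using scalar_prod_self_nonneg[of u] by linarith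
    next
      assume "u \<noteq> 0\<^sub>v m"
      then have "0 < u \<bullet> u" by (rule scalar_prod_self_pos[OF u])
      moreover have "0 \<le> c / 4 * (x \<bullet> x)" using scalar_prod_self_nonneg[of x] c by simp
      ultimately show ?thesis by linarith
    qed
    then show ?thesis using ge by linarith
  qed
  then show ?thesis by blast
qed

section \<open>Block-diagonal and selection matrices\<close>

lemma sum_list_Suc_upt: "sum_list (map f [1..<Suc q]) = (\<Sum>k\<in>{1..q}. f k)"
  for f :: "nat \<Rightarrow> 'a :: comm_monoid_add"
  by (simp add: interv_sum_list_conv_sum_set_nat atLeastLessThanSuc_atLeastAtMost del: upt_Suc)

lemma vstack_carrier:
  assumes "\<And>k. k \<in> set ks \<Longrightarrow> F k \<in> carrier_mat (m k) n"
  shows "vstack n (map F ks) \<in> carrier_mat (sum_list (map m ks)) n"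
  using assms by (induction ks) (auto simp: vstack_def)

lemma diag_block_carrier:
  assumes "\<And>k. k \<in> set ks \<Longrightarrow> P k \<in> carrier_mat (m k) (m k)"
  shows "diag_block_mat (map P ks) \<in> carrier_mat (sum_list (map m ks)) (sum_list (map m ks))"
  using assms by (induction ks) (auto simp: Let_def)

lemma diag_block_mat_Cons:
  assumes "X \<in> carrier_mat a a" "diag_block_mat Xs \<in> carrier_mat b b"
  shows "diag_block_mat (X # Xs) = four_block_mat X (0\<^sub>m a b) (0\<^sub>m b a) (diag_block_mat Xs)"
  using assms by (auto simp: Let_def)

lemma diag_block_mat_mult:
  fixes P Q :: "'a \<Rightarrow> real mat"
  assumes "\<And>k. k \<in> set ks \<Longrightarrow> P k \<in> carrier_mat (m k) (m k)"
    and "\<And>k. k \<in> set ks \<Longrightarrow> Q k \<in> carrier_mat (m k) (m k)"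
  shows "diag_block_mat (map P ks) * diag_block_mat (map Q ks) = diag_block_mat (map (\<lambda>k. P k * Q k) ks)"
  using assms
proof (induction ks)
  case (Cons k ks)
  let ?b = "sum_list (map m ks)"
  let ?DP = "diag_block_mat (map P ks)" and ?DQ = "diag_block_mat (map Q ks)"
  have P: "P k \<in> carrier_mat (m k) (m k)" and Q: "Q k \<in> carrier_mat (m k) (m k)" using Cons by auto
  have DP: "?DP \<in> carrier_mat ?b ?b"
    by (rule diag_block_carrier) (use Cons in auto)
  have DQ: "?DQ \<in> carrier_mat ?b ?b"
    by (rule diag_block_carrier) (use Cons in auto)
  have PQ: "P k * Q k \<in> carrier_mat (m k) (m k)" using P Q by simp
  have IH: "?DP * ?DQ = diag_block_mat (map (\<lambda>k. P k * Q k) ks)" using Cons by simp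
  have DPQ: "diag_block_mat (map (\<lambda>k. P k * Q k) ks) \<in> carrier_mat ?b ?b"
    using DP DQ IH[symmetric] by simp
  show ?case
    unfolding list.map diag_block_mat_Cons[OF P DP] diag_block_mat_Cons[OF Q DQ]
      diag_block_mat_Cons[OF PQ DPQ] IH[symmetric]
    by (subst mult_four_block_mat[OF P _ _ DP Q _ _ DQ]) (use P Q DP DQ in auto)
qed simp

lemma diag_block_mat_one:
  "diag_block_mat (map (\<lambda>k. 1\<^sub>m (m k)) ks) = (1\<^sub>m (sum_list (map m ks)) :: real mat)"
  using diag_block_one_mat[of "map (\<lambda>k. 1\<^sub>m (m k) :: real mat) ks"] by (simp add: comp_def)

lemma diag_block_mat_pos_def:
  assumes "\<And>k. k \<in> set ks \<Longrightarrow> P k \<in> carrier_mat (m k) (m k)" and "\<And>k. k \<in> set ks \<Longrightarrow> pos_def (P k)"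
  shows "pos_def (diag_block_mat (map P ks))"
  using assms
proof (induction ks)
  case Nil
  show ?case by (rule pos_defI[of _ 0]) auto
next
  case (Cons k ks)
  let ?b = "sum_list (map m ks)" and ?D = "diag_block_mat (map P ks)"
  have P: "P k \<in> carrier_mat (m k) (m k)" and pd: "pos_def (P k)" using Cons by auto
  have D: "?D \<in> carrier_mat ?b ?b" by (rule diag_block_carrier) (use Cons in auto)
  have pdD: "pos_def ?D" using Cons by simp
  note eq = diag_block_mat_Cons[OF P D]
  show ?case unfolding list.map eq
  proof (rule pos_defI[of _ "m k + ?b"])
    show "transpose_mat (four_block_mat (P k) (0\<^sub>m (m k) ?b) (0\<^sub>m ?b (m k)) ?D) =
        four_block_mat (P k) (0\<^sub>m (m k) ?b) (0\<^sub>m ?b (m k)) ?D"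
      by (subst transpose_four_block_mat[OF P _ _ D])
        (use pos_defD(1)[OF pd P] pos_defD(1)[OF pdD D] in auto)
    fix v :: "real vec" assume v: "v \<in> carrier_vec (m k + ?b)" "v \<noteq> 0\<^sub>v (m k + ?b)"
    define x y where "x = vec_first v (m k)" and "y = vec_last v ?b"
    have x: "x \<in> carrier_vec (m k)" and y: "y \<in> carrier_vec ?b" by (auto simp: x_def y_def)
    have v_eq: "v = x @\<^sub>v y" using v by (simp add: x_def y_def)
    have form: "v \<bullet> (four_block_mat (P k) (0\<^sub>m (m k) ?b) (0\<^sub>m ?b (m k)) ?D *\<^sub>v v) = x \<bullet> (P k *\<^sub>v x) + y \<bullet> (?D *\<^sub>v y)"
      unfolding v_eq mult_mat_vec_split[OF P D x y]
      by (rule scalar_prod_append[OF x y]) (use P D x y in auto)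
    have ge: "0 \<le> x \<bullet> (P k *\<^sub>v x)" "0 \<le> y \<bullet> (?D *\<^sub>v y)"
      using pos_defD(2)[OF pd P x] pos_defD(2)[OF pdD D y] P D x y
      by (cases "x = 0\<^sub>v (m k)"; cases "y = 0\<^sub>v ?b"; force)+
    have "x \<noteq> 0\<^sub>v (m k) \<or> y \<noteq> 0\<^sub>v ?b"
      using v v_eq by auto
    then show "0 < v \<bullet> (four_block_mat (P k) (0\<^sub>m (m k) ?b) (0\<^sub>m ?b (m k)) ?D *\<^sub>v v)"
      unfolding form using ge pos_defD(2)[OF pd P x] pos_defD(2)[OF pdD D y] by fastforce
  qed (use P D in auto)
qed

text \<open>The source of the clique-wise sums: a block-diagonal matrix between a stack and its
  transpose never mixes two blocks. Stating it by entries avoids sums of matrices.\<close>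

lemma vstack_diag_congruence:
  fixes F W :: "'a \<Rightarrow> real mat"
  assumes "\<And>k. k \<in> set ks \<Longrightarrow> F k \<in> carrier_mat (m k) n"
    and "\<And>k. k \<in> set ks \<Longrightarrow> W k \<in> carrier_mat (m k) (m k)"
    and "\<alpha> < n" "\<beta> < n"
  shows "(transpose_mat (vstack n (map F ks)) * diag_block_mat (map W ks) * vstack n (map F ks)) $$ (\<alpha>, \<beta>)
    = sum_list (map (\<lambda>k. (transpose_mat (F k) * W k * F k) $$ (\<alpha>, \<beta>)) ks)"
  using assms
proof (induction ks)
  case Nil
  then show ?case by (simp add: vstack_def scalar_prod_def)
next
  case (Cons k ks)
  let ?b = "sum_list (map m ks)" and ?D = "diag_block_mat (map W ks)" and ?E = "vstack n (map F ks)"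
  have F: "F k \<in> carrier_mat (m k) n" and W: "W k \<in> carrier_mat (m k) (m k)" using Cons by auto
  have D: "?D \<in> carrier_mat ?b ?b" by (rule diag_block_carrier) (use Cons in auto)
  have E: "?E \<in> carrier_mat ?b n" by (rule vstack_carrier) (use Cons in auto)
  have FT: "transpose_mat (F k) \<in> carrier_mat n (m k)" and ET0: "transpose_mat ?E \<in> carrier_mat n ?b"
    using F E by auto
  have FW: "transpose_mat (F k) * W k \<in> carrier_mat n (m k)" and EW: "transpose_mat ?E * ?D \<in> carrier_mat n ?b"
    using FT ET0 W D by auto
  \<comment> \<open>Stacking is a four-block matrix whose right blocks have width 0; after
    transposition the lower blocks have height 0. Thus the four-block product rule applies.\<close>
  have E': "vstack n (map F (k # ks)) = four_block_mat (F k) (0\<^sub>m (m k) 0) ?E (0\<^sub>m ?b 0)"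
    using F E by (auto simp: vstack_def append_rows_def)
  have ET: "transpose_mat (vstack n (map F (k # ks))) =
      four_block_mat (transpose_mat (F k)) (transpose_mat ?E) (0\<^sub>m 0 (m k)) (0\<^sub>m 0 ?b)"
    unfolding E' by (subst transpose_four_block_mat[OF F _ E]) auto
  have "transpose_mat (vstack n (map F (k # ks))) * diag_block_mat (map W (k # ks)) =
      four_block_mat (transpose_mat (F k) * W k) (transpose_mat ?E * ?D) (0\<^sub>m 0 (m k)) (0\<^sub>m 0 ?b)"
    unfolding ET unfolding list.map diag_block_mat_Cons[OF W D]
    by (subst mult_four_block_mat[OF FT ET0 _ _ W _ _ D]) (use F W D E in auto)
  also have "\<dots> * vstack n (map F (k # ks)) =
      four_block_mat (transpose_mat (F k) * W k * F k + transpose_mat ?E * ?D * ?E) (0\<^sub>m n 0) (0\<^sub>m 0 n) (0\<^sub>m 0 0)"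
    unfolding E'
    by (subst mult_four_block_mat[OF FW EW _ _ F _ E]) (use F W D E in auto)
  finally have eq: "transpose_mat (vstack n (map F (k # ks))) * diag_block_mat (map W (k # ks)) *
      vstack n (map F (k # ks)) = \<dots>" .
  have "(transpose_mat ?E * ?D * ?E) $$ (\<alpha>, \<beta>)
    = sum_list (map (\<lambda>k. (transpose_mat (F k) * W k * F k) $$ (\<alpha>, \<beta>)) ks)"
    using Cons by simp
  then show ?case unfolding eq using F E W D Cons.prems(3,4) by simp
qed

text \<open>\<open>E_node\<close>, \<open>E_clique\<close> and \<open>E_mat\<close> are all of this
  shape; the list of selected coordinates turns stacking into concatenation.\<close>

definition sel_mat :: "nat \<Rightarrow> nat list \<Rightarrow> real mat" where
  "sel_mat n L = mat (length L) n (\<lambda>(r, c). if c = L ! r then 1 else 0)"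

lemma sel_mat_carrier [simp]: "sel_mat n L \<in> carrier_mat (length L) n"
  by (simp add: sel_mat_def)

lemma dim_sel_mat [simp]: "dim_row (sel_mat n L) = length L" "dim_col (sel_mat n L) = n"
  by (simp_all add: sel_mat_def)

lemma sel_mat_append: "sel_mat n (xs @ ys) = append_rows (sel_mat n xs) (sel_mat n ys)"
  by (rule eq_matI) (auto simp: sel_mat_def append_rows_def nth_append)

lemma vstack_sel_mat: "vstack n (map (\<lambda>x. sel_mat n (L x)) xs) = sel_mat n (concat (map L xs))"
proof (induction xs)
  case Nil
  show ?case by (auto simp: vstack_def sel_mat_def)
next
  case (Cons x xs)
  then show ?case by (simp add: vstack_def sel_mat_append)
qed

text \<open>The result is the coordinate projection onto \<open>L\<close>; distinctness keeps every
  coordinate from being counted twice.\<close>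

lemma sel_mat_gram:
  assumes "distinct L" "set L \<subseteq> {..<n}"
  shows "transpose_mat (sel_mat n L) * sel_mat n L = mat_diag n (\<lambda>\<alpha>. if \<alpha> \<in> set L then 1 else 0)"
proof (rule eq_matI)
  fix \<alpha> \<beta> assume "\<alpha> < dim_row (mat_diag n (\<lambda>\<alpha>. if \<alpha> \<in> set L then 1 else 0 :: real))"
    "\<beta> < dim_col (mat_diag n (\<lambda>\<alpha>. if \<alpha> \<in> set L then 1 else 0 :: real))"
  then have lt: "\<alpha> < n" "\<beta> < n" by (auto simp: mat_diag_def)
  define g :: "nat \<Rightarrow> real" where "g x = (if \<alpha> = x then 1 else 0) * (if \<beta> = x then 1 else 0)" for x
  have "(transpose_mat (sel_mat n L) * sel_mat n L) $$ (\<alpha>, \<beta>) = (\<Sum>r<length L. g (L ! r))"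
    using lt by (simp add: sel_mat_def scalar_prod_def atLeast0LessThan g_def)
  also have "\<dots> = (\<Sum>x\<in>set L. g x)"
    by (rule sum.reindex_bij_betw) (rule bij_betw_nth[OF assms(1)], auto)
  also have "\<dots> = (\<Sum>x\<in>set L. if x = \<alpha> then (if \<beta> = \<alpha> then 1 else 0) else 0)"
    by (intro sum.cong) (auto simp: g_def)
  also have "\<dots> = mat_diag n (\<lambda>\<alpha>. if \<alpha> \<in> set L then 1 else 0) $$ (\<alpha>, \<beta>)"
    using lt by (simp add: mat_diag_def)
  finally show "(transpose_mat (sel_mat n L) * sel_mat n L) $$ (\<alpha>, \<beta>) =
      mat_diag n (\<lambda>\<alpha>. if \<alpha> \<in> set L then 1 else 0) $$ (\<alpha>, \<beta>)" .
qed (auto simp: mat_diag_def sel_mat_def)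

text \<open>Columns of the selection matrix outside \<open>L\<close> are zero, so the congruence
  just pads \<open>W\<close> with zeros.\<close>

lemma sel_mat_congruence_support:
  assumes W: "W \<in> carrier_mat (length L) (length L)" and lt: "\<alpha> < n" "\<beta> < n"
    and nz: "(transpose_mat (sel_mat n L) * W * sel_mat n L) $$ (\<alpha>, \<beta>) \<noteq> 0"
  shows "\<alpha> \<in> set L \<and> \<beta> \<in> set L"
proof (rule ccontr)
  assume out: "\<not> (\<alpha> \<in> set L \<and> \<beta> \<in> set L)"
  let ?S = "sel_mat n L"
  have S: "?S \<in> carrier_mat (length L) n" by simp
  have c0: "col ?S \<gamma> = 0\<^sub>v (length L)" if "\<gamma> \<notin> set L" "\<gamma> < n" for \<gamma>
    using that by (intro eq_vecI) (auto simp: sel_mat_def)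
  have "(transpose_mat ?S * W * ?S) $$ (\<alpha>, \<beta>) = row (transpose_mat ?S * W) \<alpha> \<bullet> col ?S \<beta>"
    using lt S by simp
  moreover have "row (transpose_mat ?S * W) \<alpha> \<in> carrier_vec (length L)"
    by (rule carrier_vecI) (use W in simp)
  ultimately have "\<beta> \<in> set L" using nz c0[of \<beta>] lt(2) by (metis scalar_prod_right_zero)
  moreover have "transpose_mat ?S * W * ?S = transpose_mat ?S * (W * ?S)"
    by (rule assoc_mult_mat[of _ n "length L" _ "length L" _ n]) (use W in auto)
  then have "(transpose_mat ?S * W * ?S) $$ (\<alpha>, \<beta>) = col ?S \<alpha> \<bullet> col (W * ?S) \<beta>"
    using lt by simp
  moreover have "col (W * ?S) \<beta> \<in> carrier_vec (length L)"
    by (rule carrier_vecI) (use W in simp)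
  ultimately have "\<alpha> \<in> set L" using nz c0[of \<alpha>] lt(1) by (metis scalar_prod_left_zero)
  then show False using out \<open>\<beta> \<in> set L\<close> by simp
qed

text \<open>The outer factors combine to the coordinate projection onto \<open>L\<close> on either
  side, and \<open>X\<close> is fixed by it. So a matrix supported on a clique comes from a block of
  that clique.\<close>

lemma sel_mat_restrict_extend:
  assumes L: "distinct L" "set L \<subseteq> {..<n}" and X: "X \<in> carrier_mat n n"
    and supp: "\<And>\<alpha> \<beta>. \<alpha> < n \<Longrightarrow> \<beta> < n \<Longrightarrow> X $$ (\<alpha>, \<beta>) \<noteq> 0 \<Longrightarrow> \<alpha> \<in> set L \<and> \<beta> \<in> set L"
  shows "transpose_mat (sel_mat n L) * (sel_mat n L * X * transpose_mat (sel_mat n L)) * sel_mat n L = X"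
proof -
  let ?S = "sel_mat n L" and ?T = "transpose_mat (sel_mat n L)" and ?l = "length L"
  let ?f = "\<lambda>\<alpha>. if \<alpha> \<in> set L then 1 else 0 :: real"
  have S: "?S \<in> carrier_mat ?l n" and T: "?T \<in> carrier_mat n ?l" by simp_all
  have SX: "?S * X \<in> carrier_mat ?l n" by (rule mult_carrier_mat[OF S X])
  have XT: "X * ?T \<in> carrier_mat n ?l" by (rule mult_carrier_mat[OF X T])
  have "?T * (?S * X * ?T) * ?S = (?T * (?S * (X * ?T))) * ?S"
    using assoc_mult_mat[OF S X T] by simp
  also have "?T * (?S * (X * ?T)) = (?T * ?S) * (X * ?T)"
    by (rule assoc_mult_mat[OF T S XT, symmetric])
  also have "(?T * ?S) * (X * ?T) * ?S = (?T * ?S) * ((X * ?T) * ?S)"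
    by (rule assoc_mult_mat[OF mult_carrier_mat[OF T S] XT S])
  also have "X * ?T * ?S = X * (?T * ?S)"
    by (rule assoc_mult_mat[OF X T S])
  also have "?T * ?S = mat_diag n ?f" by (rule sel_mat_gram[OF L])
  also have "mat_diag n ?f * (X * mat_diag n ?f) = X"
  proof (rule eq_matI)
    fix i j assume ij: "i < dim_row X" "j < dim_col X"
    then have "(mat_diag n ?f * (X * mat_diag n ?f)) $$ (i, j) = ?f i * (X $$ (i, j) * ?f j)"
      using X by (simp add: mat_diag_mult_left[where nr = n] mat_diag_mult_right[where nr = n])
    also have "\<dots> = X $$ (i, j)" using supp[of i j] ij X by auto
    finally show "(mat_diag n ?f * (X * mat_diag n ?f)) $$ (i, j) = X $$ (i, j)" .
  qed (use X in \<open>auto simp: mat_diag_def\<close>)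
  finally show ?thesis .
qed

section \<open>The lifted Lyapunov inequality\<close>

text \<open>With \<open>Y\<close> the inverse Gram matrix and \<open>T\<close> the transpose of
  \<open>E\<close>, the factor \<open>Y * T\<close> is \<open>F\<close>, so a lifted matrix acts as
  \<open>E\<close>, \<open>X\<close> and \<open>F\<close> in succession.\<close>

lemma sandwich_mult_vec:
  fixes E X Y T :: "real mat"
  assumes "E \<in> carrier_mat m n" "X \<in> carrier_mat n n" "Y \<in> carrier_mat n n" "T \<in> carrier_mat n m"
    and "w \<in> carrier_vec m"
  shows "(E * X * Y * T) *\<^sub>v w = E *\<^sub>v (X *\<^sub>v ((Y * T) *\<^sub>v w))"
proof -
  have "(E * X * Y * T) *\<^sub>v w = (E * X * Y) *\<^sub>v (T *\<^sub>v w)"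
    by (rule assoc_mult_mat_vec[of _ m n]) (use assms in auto)
  also have "\<dots> = (E * X) *\<^sub>v (Y *\<^sub>v (T *\<^sub>v w))"
    by (rule assoc_mult_mat_vec[of _ m n _ n]) (use assms in auto)
  also have "\<dots> = E *\<^sub>v (X *\<^sub>v (Y *\<^sub>v (T *\<^sub>v w)))"
    by (rule assoc_mult_mat_vec[of _ m n _ n]) (use assms in auto)
  also have "Y *\<^sub>v (T *\<^sub>v w) = (Y * T) *\<^sub>v w"
    by (rule assoc_mult_mat_vec[symmetric]) (use assms in auto)
  finally show ?thesis .
qed

lemma scalar_prod_transpose_mult_vec:
  assumes "X \<in> carrier_mat m m" "u \<in> carrier_vec m" "v \<in> carrier_vec m"
  shows "u \<bullet> (transpose_mat X *\<^sub>v v) = v \<bullet> (X *\<^sub>v (u :: real vec))"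
  using transpose_move[OF assms(1,3,2)] comm_scalar_prod[of u m "transpose_mat X *\<^sub>v v"] assms by simp

lemma mult_mat_zero_vec: "X \<in> carrier_mat m n \<Longrightarrow> X *\<^sub>v 0\<^sub>v n = (0\<^sub>v m :: real vec)"
  by (intro eq_vecI) auto

lemma lyapunov_form:
  fixes P X :: "real mat"
  assumes P: "P \<in> carrier_mat n n" "transpose_mat P = P" and X: "X \<in> carrier_mat n n"
    and x: "x \<in> carrier_vec n"
  shows "x \<bullet> ((transpose_mat X * P + P * X) *\<^sub>v x) = 2 * (x \<bullet> (P *\<^sub>v (X *\<^sub>v x)))"
    and "transpose_mat (transpose_mat X * P + P * X) = transpose_mat X * P + P * X"
proof -
  let ?XT = "transpose_mat X"
  have XT: "?XT \<in> carrier_mat n n" and c1: "?XT * P \<in> carrier_mat n n" and c2: "P * X \<in> carrier_mat n n"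
    using P X by auto
  have Px: "P *\<^sub>v x \<in> carrier_vec n" "X *\<^sub>v x \<in> carrier_vec n" using P X x by auto
  have "x \<bullet> (?XT *\<^sub>v (P *\<^sub>v x)) = (P *\<^sub>v x) \<bullet> (X *\<^sub>v x)"
    by (rule scalar_prod_transpose_mult_vec[OF X x Px(1)])
  also have "\<dots> = x \<bullet> (P *\<^sub>v (X *\<^sub>v x))"
    using transpose_move[OF P(1) x Px(2)] P(2) by simp
  finally have 1: "x \<bullet> (?XT *\<^sub>v (P *\<^sub>v x)) = x \<bullet> (P *\<^sub>v (X *\<^sub>v x))" .
  have "(?XT * P + P * X) *\<^sub>v x = ?XT *\<^sub>v (P *\<^sub>v x) + P *\<^sub>v (X *\<^sub>v x)"
    unfolding add_mult_distrib_mat_vec[OF c1 c2 x] assoc_mult_mat_vec[OF XT P(1) x]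
      assoc_mult_mat_vec[OF P(1) X x] ..
  then show "x \<bullet> ((?XT * P + P * X) *\<^sub>v x) = 2 * (x \<bullet> (P *\<^sub>v (X *\<^sub>v x)))"
    using 1 scalar_prod_add_distrib[of x n "?XT *\<^sub>v (P *\<^sub>v x)" "P *\<^sub>v (X *\<^sub>v x)"] x XT Px P by simp
  show "transpose_mat (?XT * P + P * X) = ?XT * P + P * X"
    unfolding transpose_add[OF c1 c2] transpose_mult[OF XT P(1)] transpose_mult[OF P(1) X] P(2)
    using comm_add_mat[OF c1 c2] by simp
qed

text \<open>
  With \<open>v = Q\<^sup>-\<^sup>1 w\<close> both matrix inequalities are statements about one quadratic form, of the matrix
  \<open>H\<close> below: the first one on the whole space, up to a multiple of \<open>M\<close>, the second one on the
  range of \<open>E\<close>, the kernel of \<open>M\<close>.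
\<close>

lemma lifted_lyapunov_iff:
  fixes E A B Q W Z :: "real mat"
  defines "F \<equiv> minv (transpose_mat E * E) * transpose_mat E"
  defines "K \<equiv> F * (Z * W) * E"
  defines "P \<equiv> transpose_mat E * W * E"
  assumes E: "E \<in> carrier_mat m n" and A: "A \<in> carrier_mat n n" and B: "B \<in> carrier_mat n n"
    and Gi: "minv (transpose_mat E * E) \<in> carrier_mat n n"
    and GiT: "transpose_mat (minv (transpose_mat E * E)) = minv (transpose_mat E * E)"
    and FE: "F * E = 1\<^sub>m n"
    and Q: "Q \<in> carrier_mat m m" and W: "W \<in> carrier_mat m m"
    and QW: "Q * W = 1\<^sub>m m" and WQ: "W * Q = 1\<^sub>m m"
    and QT: "transpose_mat Q = Q" and WT: "transpose_mat W = W"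
    and Z: "Z \<in> carrier_mat m m"
  shows "(\<exists>\<rho>. neg_def (Phi (lift_mat E A) (lift_mat E B) Q Z + \<rho> \<cdot>\<^sub>m (Q * M_mat E * Q))) \<longleftrightarrow>
    neg_def (transpose_mat (A + B * K) * P + P * (A + B * K))"
proof -
  let ?Gi = "minv (transpose_mat E * E)" and ?ET = "transpose_mat E"
  define M At Bt Kt where "M = M_mat E" and "At = lift_mat E A" and "Bt = lift_mat E B" and "Kt = Z * W"
  have ET: "?ET \<in> carrier_mat n m" using E by simp
  have F: "F \<in> carrier_mat n m" unfolding F_def by (rule mult_carrier_mat[OF Gi ET])
  have M_eq: "M = 1\<^sub>m m - E * F"
    using E assoc_mult_mat[OF E Gi ET] by (simp add: M_def M_mat_def F_def)
  have EF: "E * F \<in> carrier_mat m m" by (rule mult_carrier_mat[OF E F])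
  have M: "M \<in> carrier_mat m m" unfolding M_eq using EF by (metis minus_carrier_mat)
  have "transpose_mat (E * F) = transpose_mat F * ?ET" by (rule transpose_mult[OF E F])
  also have "transpose_mat F = E * ?Gi" unfolding F_def transpose_mult[OF Gi ET] GiT by simp
  also have "E * ?Gi * ?ET = E * F" unfolding F_def by (rule assoc_mult_mat[OF E Gi ET])
  finally have MT: "transpose_mat M = M"
    unfolding M_eq using transpose_minus[OF one_carrier_mat EF] by simp
  have At: "At \<in> carrier_mat m m" and Bt: "Bt \<in> carrier_mat m m"
    unfolding At_def Bt_def lift_mat_def by (rule mult_carrier_mat[of _ m n]; use E A B Gi in auto)+
  have Kt: "Kt \<in> carrier_mat m m" unfolding Kt_def by (rule mult_carrier_mat[OF Z W])
  have FK: "F * Kt \<in> carrier_mat n m" by (rule mult_carrier_mat[OF F Kt])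
  have K: "K \<in> carrier_mat n n" unfolding K_def Kt_def[symmetric] by (rule mult_carrier_mat[OF FK E])
  have BK: "B * K \<in> carrier_mat n n" by (rule mult_carrier_mat[OF B K])
  have ABK: "A + B * K \<in> carrier_mat n n" using A BK by simp
  have EW: "?ET * W \<in> carrier_mat n m" by (rule mult_carrier_mat[OF ET W])
  have P: "P \<in> carrier_mat n n" unfolding P_def by (rule mult_carrier_mat[OF EW E])
  have PT: "transpose_mat P = P"
    unfolding P_def transpose_mult[OF EW E] transpose_mult[OF ET W] WT transpose_transpose
    by (rule assoc_mult_mat[OF ET W E, symmetric])
  define g where "g w = A *\<^sub>v (F *\<^sub>v w) + B *\<^sub>v (F *\<^sub>v (Kt *\<^sub>v w))" for w
  have g: "g w \<in> carrier_vec n" if "w \<in> carrier_vec m" for w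
    using that A B F Kt by (simp add: g_def)
  \<comment> \<open>This is \<open>W * (At + Bt * Kt)\<close>, regrouped around the common factor
    \<open>E\<close>.\<close>
  define H where "H = W * E * (A * F + B * (F * Kt))"
  have WE: "W * E \<in> carrier_mat m n" by (rule mult_carrier_mat[OF W E])
  have AF: "A * F \<in> carrier_mat n m" and BFK: "B * (F * Kt) \<in> carrier_mat n m"
    using mult_carrier_mat[OF A F] mult_carrier_mat[OF B FK] by auto
  have ABF: "A * F + B * (F * Kt) \<in> carrier_mat n m" using AF BFK by simp
  have H: "H \<in> carrier_mat m m" unfolding H_def by (rule mult_carrier_mat[OF WE ABF])
  have Hw: "H *\<^sub>v w = W *\<^sub>v (E *\<^sub>v g w)" if w: "w \<in> carrier_vec m" for w
  proof -
    have "(A * F + B * (F * Kt)) *\<^sub>v w = g w"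
      unfolding add_mult_distrib_mat_vec[OF AF BFK w] assoc_mult_mat_vec[OF A F w]
        assoc_mult_mat_vec[OF B FK w] assoc_mult_mat_vec[OF F Kt w] g_def ..
    then show ?thesis
      unfolding H_def assoc_mult_mat_vec[OF WE ABF w] using assoc_mult_mat_vec[OF W E g[OF w]] by simp
  qed
  \<comment> \<open>On the range of \<open>E\<close> the map \<open>g\<close> is the closed loop:
    \<open>F * E = 1\<^sub>m n\<close> turns \<open>g (E *\<^sub>v x)\<close> into
    \<open>(A + B * K) *\<^sub>v x\<close>.\<close>
  have form_P: "x \<bullet> ((transpose_mat (A + B * K) * P + P * (A + B * K)) *\<^sub>v x) = 2 * ((E *\<^sub>v x) \<bullet> (H *\<^sub>v (E *\<^sub>v x)))"
    if x: "x \<in> carrier_vec n" for x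
  proof -
    have Ex: "E *\<^sub>v x \<in> carrier_vec m" using E x by simp
    have FEx: "F *\<^sub>v (E *\<^sub>v x) = x" using assoc_mult_mat_vec[OF F E x] FE x by simp
    have "(A + B * K) *\<^sub>v x = A *\<^sub>v x + B *\<^sub>v (K *\<^sub>v x)"
      unfolding add_mult_distrib_mat_vec[OF A BK x] assoc_mult_mat_vec[OF B K x] ..
    also have "K *\<^sub>v x = F *\<^sub>v (Kt *\<^sub>v (E *\<^sub>v x))"
      unfolding K_def Kt_def[symmetric] assoc_mult_mat_vec[OF FK E x] assoc_mult_mat_vec[OF F Kt Ex] ..
    finally have gx: "(A + B * K) *\<^sub>v x = g (E *\<^sub>v x)" by (simp add: g_def FEx)
    have Eg: "E *\<^sub>v g (E *\<^sub>v x) \<in> carrier_vec m" using E g[OF Ex] by simp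
    have WEg: "W *\<^sub>v (E *\<^sub>v g (E *\<^sub>v x)) \<in> carrier_vec m" using W Eg by simp
    have "P *\<^sub>v g (E *\<^sub>v x) = ?ET *\<^sub>v (W *\<^sub>v (E *\<^sub>v g (E *\<^sub>v x)))"
      unfolding P_def assoc_mult_mat_vec[OF EW E g[OF Ex]] assoc_mult_mat_vec[OF ET W Eg] ..
    then have "x \<bullet> (P *\<^sub>v ((A + B * K) *\<^sub>v x)) = (E *\<^sub>v x) \<bullet> (H *\<^sub>v (E *\<^sub>v x))"
      unfolding gx Hw[OF Ex] using transpose_move[OF ET x WEg] by simp
    then show ?thesis using lyapunov_form(1)[OF P PT ABK x] by simp
  qed
  have lift: "At *\<^sub>v w = E *\<^sub>v (A *\<^sub>v (F *\<^sub>v w))" "Bt *\<^sub>v w = E *\<^sub>v (B *\<^sub>v (F *\<^sub>v w))"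
    if "w \<in> carrier_vec m" for w
    unfolding At_def Bt_def lift_mat_def F_def
    using sandwich_mult_vec[OF E A Gi ET that] sandwich_mult_vec[OF E B Gi ET that] by auto
  have AtT: "transpose_mat At \<in> carrier_mat m m" and BtT: "transpose_mat Bt \<in> carrier_mat m m"
    and ZT: "transpose_mat Z \<in> carrier_mat m m" using At Bt Z by auto
  note c1 = mult_carrier_mat[OF Q AtT] and c2 = mult_carrier_mat[OF At Q]
    and c3 = mult_carrier_mat[OF ZT BtT] and c4 = mult_carrier_mat[OF Bt Z]
  have QM: "Q * M \<in> carrier_mat m m" by (rule mult_carrier_mat[OF Q M])
  have QMQ: "Q * M * Q \<in> carrier_mat m m" by (rule mult_carrier_mat[OF QM Q])
  have c12: "Q * transpose_mat At + At * Q \<in> carrier_mat m m"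
    and c123: "Q * transpose_mat At + At * Q + transpose_mat Z * transpose_mat Bt \<in> carrier_mat m m"
    using c2 c3 c4 by auto
  have Phi_carr: "Phi At Bt Q Z \<in> carrier_mat m m" unfolding Phi_def using c4 by simp
  have PhiT: "transpose_mat (Phi At Bt Q Z) = Phi At Bt Q Z"
  proof -
    have "transpose_mat (Phi At Bt Q Z) = (At * Q + Q * transpose_mat At) + Bt * Z + transpose_mat Z * transpose_mat Bt"
      unfolding Phi_def transpose_add[OF c123 c4] transpose_add[OF c12 c3] transpose_add[OF c1 c2]
        transpose_mult[OF Q AtT] transpose_mult[OF At Q] transpose_mult[OF ZT BtT] transpose_mult[OF Bt Z]
        QT transpose_transpose ..
    also have "\<dots> = (Q * transpose_mat At + At * Q) + (transpose_mat Z * transpose_mat Bt + Bt * Z)"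
      unfolding comm_add_mat[OF c2 c1] assoc_add_mat[OF c12 c4 c3] comm_add_mat[OF c4 c3] ..
    also have "\<dots> = Phi At Bt Q Z" unfolding Phi_def by (rule assoc_add_mat[OF c12 c3 c4, symmetric])
    finally show ?thesis .
  qed
  have QMQT: "transpose_mat (Q * M * Q) = Q * M * Q"
    unfolding transpose_mult[OF QM Q] transpose_mult[OF Q M] QT MT
    by (rule assoc_mult_mat[OF Q M Q, symmetric])
  define X where "X \<rho> = Phi At Bt Q Z + \<rho> \<cdot>\<^sub>m (Q * M * Q)" for \<rho>
  have rQ: "\<rho> \<cdot>\<^sub>m (Q * M * Q) \<in> carrier_mat m m" for \<rho> using QMQ by simp
  have X: "X \<rho> \<in> carrier_mat m m" for \<rho> unfolding X_def using rQ by simp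
  have XT: "transpose_mat (X \<rho>) = X \<rho>" for \<rho>
  proof -
    have "transpose_mat (\<rho> \<cdot>\<^sub>m (Q * M * Q)) = \<rho> \<cdot>\<^sub>m transpose_mat (Q * M * Q)"
      by (rule eq_matI) (use QMQ in auto)
    then show ?thesis unfolding X_def transpose_add[OF Phi_carr rQ] PhiT QMQT by simp
  qed
  \<comment> \<open>The four terms of \<open>Phi\<close> pair up as transposes, hence the factor 2.
    Since \<open>v = W *\<^sub>v w\<close>, the action of \<open>Z\<close> on \<open>v\<close> is
    that of \<open>Kt\<close> on \<open>w\<close>.\<close>
  have form_X: "v \<bullet> (X \<rho> *\<^sub>v v) = 2 * (w \<bullet> (H *\<^sub>v w)) + \<rho> * (w \<bullet> (M *\<^sub>v w))"
    if v: "v \<in> carrier_vec m" and w_def: "w = Q *\<^sub>v v" for v w \<rho>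
  proof -
    have w: "w \<in> carrier_vec m" using Q v by (simp add: w_def)
    have Ww: "W *\<^sub>v w = v" using assoc_mult_mat_vec[OF W Q v] WQ v by (simp add: w_def)
    have Zv: "Z *\<^sub>v v = Kt *\<^sub>v w" unfolding Kt_def assoc_mult_mat_vec[OF Z W w] Ww ..
    have Kw: "Kt *\<^sub>v w \<in> carrier_vec m" using Kt w by simp
    have Mw: "M *\<^sub>v w \<in> carrier_vec m" using M w by simp
    have AtTv: "transpose_mat At *\<^sub>v v \<in> carrier_vec m" "transpose_mat Bt *\<^sub>v v \<in> carrier_vec m"
      "At *\<^sub>v w \<in> carrier_vec m" "Bt *\<^sub>v (Kt *\<^sub>v w) \<in> carrier_vec m"
      using AtT BtT v At Bt w Kw by auto
    have t1: "v \<bullet> ((Q * transpose_mat At) *\<^sub>v v) = v \<bullet> (At *\<^sub>v w)"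
      unfolding assoc_mult_mat_vec[OF Q AtT v] transpose_move[OF Q v AtTv(1)] QT w_def[symmetric]
      by (rule scalar_prod_transpose_mult_vec[OF At w v])
    have t2: "v \<bullet> ((At * Q) *\<^sub>v v) = v \<bullet> (At *\<^sub>v w)"
      unfolding assoc_mult_mat_vec[OF At Q v] w_def ..
    have t3: "v \<bullet> ((transpose_mat Z * transpose_mat Bt) *\<^sub>v v) = v \<bullet> (Bt *\<^sub>v (Kt *\<^sub>v w))"
      unfolding assoc_mult_mat_vec[OF ZT BtT v] transpose_move[OF ZT v AtTv(2)] transpose_transpose Zv
      by (rule scalar_prod_transpose_mult_vec[OF Bt Kw v])
    have t4: "v \<bullet> ((Bt * Z) *\<^sub>v v) = v \<bullet> (Bt *\<^sub>v (Kt *\<^sub>v w))"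
      unfolding assoc_mult_mat_vec[OF Bt Z v] Zv ..
    have t5: "v \<bullet> ((\<rho> \<cdot>\<^sub>m (Q * M * Q)) *\<^sub>v v) = \<rho> * (w \<bullet> (M *\<^sub>v w))"
    proof -
      have "(Q * M * Q) *\<^sub>v v = Q *\<^sub>v (M *\<^sub>v w)"
        unfolding assoc_mult_mat_vec[OF QM Q v] w_def[symmetric] assoc_mult_mat_vec[OF Q M w] ..
      then have "v \<bullet> ((Q * M * Q) *\<^sub>v v) = w \<bullet> (M *\<^sub>v w)"
        using transpose_move[OF Q v Mw] QT by (simp add: w_def)
      moreover have "(\<rho> \<cdot>\<^sub>m (Q * M * Q)) *\<^sub>v v = \<rho> \<cdot>\<^sub>v ((Q * M * Q) *\<^sub>v v)"
        using QMQ v by (intro eq_vecI) auto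
      ultimately show ?thesis using QMQ v by simp
    qed
    have add: "v \<bullet> ((Y1 + Y2) *\<^sub>v v) = v \<bullet> (Y1 *\<^sub>v v) + v \<bullet> (Y2 *\<^sub>v v)"
      if "Y1 \<in> carrier_mat m m" "Y2 \<in> carrier_mat m m" for Y1 Y2
      using add_mult_distrib_mat_vec[OF that v] scalar_prod_add_distrib[OF v, of "Y1 *\<^sub>v v" "Y2 *\<^sub>v v"] that v
      by simp
    have "v \<bullet> (X \<rho> *\<^sub>v v) = 2 * (v \<bullet> (At *\<^sub>v w) + v \<bullet> (Bt *\<^sub>v (Kt *\<^sub>v w))) + \<rho> * (w \<bullet> (M *\<^sub>v w))"
      unfolding X_def add[OF Phi_carr rQ] t5
      unfolding Phi_def add[OF c123 c4] add[OF c12 c3] add[OF c1 c2] t1 t2 t3 t4 by simp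
    also have "v \<bullet> (At *\<^sub>v w) + v \<bullet> (Bt *\<^sub>v (Kt *\<^sub>v w)) = v \<bullet> (E *\<^sub>v g w)"
    proof -
      have "E *\<^sub>v g w = At *\<^sub>v w + Bt *\<^sub>v (Kt *\<^sub>v w)"
        unfolding g_def lift(1)[OF w] lift(2)[OF Kw]
        by (rule mult_add_distrib_mat_vec[OF E]) (use A B F w Kw in auto)
      then show ?thesis using scalar_prod_add_distrib[OF v AtTv(3,4)] by simp
    qed
    also have "\<dots> = w \<bullet> (H *\<^sub>v w)"
    proof -
      have "E *\<^sub>v g w \<in> carrier_vec m" using E g[OF w] by simp
      then show ?thesis unfolding Hw[OF w] using transpose_move[OF W w] WT Ww by simp
    qed
    finally show ?thesis .
  qed
  have "(\<exists>\<rho>. neg_def (X \<rho>)) \<longleftrightarrow> neg_def (transpose_mat (A + B * K) * P + P * (A + B * K))"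
    (is "?L \<longleftrightarrow> neg_def ?Y")
  proof -
    have Y: "?Y \<in> carrier_mat n n" using mult_carrier_mat[OF P ABK] by simp
    have YT: "transpose_mat ?Y = ?Y" by (rule lyapunov_form(2)[OF P PT ABK zero_carrier_vec])
    have Q0: "Q *\<^sub>v v \<noteq> 0\<^sub>v m" if "v \<in> carrier_vec m" "v \<noteq> 0\<^sub>v m" for v
    proof
      assume "Q *\<^sub>v v = 0\<^sub>v m"
      then have "W *\<^sub>v (Q *\<^sub>v v) = 0\<^sub>v m" using mult_mat_zero_vec[OF W] by simp
      then show False using assoc_mult_mat_vec[OF W Q that(1)] WQ that by simp
    qed
    show ?thesis
    proof
      assume ?L
      then obtain \<rho> where \<rho>: "neg_def (X \<rho>)" ..
      show "neg_def ?Y"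
        unfolding neg_def_iff[OF Y]
      proof (intro conjI ballI impI YT)
        fix x :: "real vec" assume x: "x \<in> carrier_vec n" "x \<noteq> 0\<^sub>v n"
        define w v where "w = E *\<^sub>v x" and "v = W *\<^sub>v w"
        have w: "w \<in> carrier_vec m" using E x by (simp add: w_def)
        have v: "v \<in> carrier_vec m" using W w by (simp add: v_def)
        have Qv: "w = Q *\<^sub>v v" using assoc_mult_mat_vec[OF Q W w] QW w by (simp add: v_def)
        have Fw: "F *\<^sub>v w = x" using assoc_mult_mat_vec[OF F E x(1)] FE x by (simp add: w_def)
        have "v \<noteq> 0\<^sub>v m" using Qv Fw x mult_mat_zero_vec[OF Q] mult_mat_zero_vec[OF F] by auto
        then have "v \<bullet> (X \<rho> *\<^sub>v v) < 0" using \<rho> v unfolding neg_def_iff[OF X] by blast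
        moreover have "M *\<^sub>v w = 0\<^sub>v m"
          unfolding M_eq minus_mult_distrib_mat_vec[OF one_carrier_mat EF w] assoc_mult_mat_vec[OF E F w] Fw
          using w E x by (simp add: w_def)
        ultimately have "2 * (w \<bullet> (H *\<^sub>v w)) < 0" unfolding form_X[OF v Qv] using w by simp
        then show "x \<bullet> (?Y *\<^sub>v x) < 0" unfolding form_P[OF x(1)] by (simp add: w_def)
      qed
    next
      assume neg: "neg_def ?Y"
      have Hneg: "- H \<in> carrier_mat m m" using H by simp
      have neg_form: "w \<bullet> (- H *\<^sub>v w) = - (w \<bullet> (H *\<^sub>v w))" if "w \<in> carrier_vec m" for w
        using H that by simp
      have "\<exists>\<rho>. \<forall>w\<in>carrier_vec m. w \<noteq> 0\<^sub>v m \<longrightarrow> 0 < w \<bullet> (- H *\<^sub>v w) + \<rho> * (w \<bullet> (M *\<^sub>v w))"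
      proof (rule finsler[OF E F FE Hneg M_eq MT])
        fix x :: "real vec" assume x: "x \<in> carrier_vec n" "x \<noteq> 0\<^sub>v n"
        have "E *\<^sub>v x \<in> carrier_vec m" using E x by simp
        moreover have "x \<bullet> (?Y *\<^sub>v x) < 0" using neg x unfolding neg_def_iff[OF Y] by blast
        ultimately show "0 < (E *\<^sub>v x) \<bullet> (- H *\<^sub>v (E *\<^sub>v x))"
          unfolding form_P[OF x(1)] by (simp add: neg_form)
      qed
      then obtain \<rho> where
        \<rho>: "\<And>w. w \<in> carrier_vec m \<Longrightarrow> w \<noteq> 0\<^sub>v m \<Longrightarrow> 0 < w \<bullet> (- H *\<^sub>v w) + \<rho> * (w \<bullet> (M *\<^sub>v w))"
        by blast
      \<comment> \<open>Finsler's lemma was applied to \<open>- H\<close>, while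
        \<open>form_X\<close> contains twice the form of \<open>H\<close>: scaling its conclusion by
        -2 gives this multiplier.\<close>
      have "neg_def (X (- 2 * \<rho>))"
        unfolding neg_def_iff[OF X]
      proof (intro conjI ballI impI XT)
        fix v :: "real vec" assume v: "v \<in> carrier_vec m" "v \<noteq> 0\<^sub>v m"
        have w: "Q *\<^sub>v v \<in> carrier_vec m" using Q v by simp
        show "v \<bullet> (X (- 2 * \<rho>) *\<^sub>v v) < 0"
          unfolding form_X[OF v(1) refl] using \<rho>[OF w Q0[OF v]] neg_form[OF w] by simp
      qed
      then show ?L by blast
    qed
  qed
  then show ?thesis unfolding X_def M_def At_def Bt_def .
qed

section \<open>Block structure induced by the cliques\<close>

text \<open>The subsystem to which the scalar coordinate belongs. For \<open>i = 0\<close> the bound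
  is \<open>offset d 1 = 0\<close>, so the least \<open>i\<close> is at least 1.\<close>

definition node :: "(nat \<Rightarrow> nat) \<Rightarrow> nat \<Rightarrow> nat" where
  "node d \<alpha> = (LEAST i. \<alpha> < offset d (Suc i))"

lemma offset_Suc: "1 \<le> i \<Longrightarrow> offset d (Suc i) = offset d i + d i"
  by (simp add: offset_def)

lemma offset_mono: "i \<le> j \<Longrightarrow> offset d i \<le> offset d j"
  unfolding offset_def by (rule sum_mono2) auto

lemma total_dim_offset: "total_dim N d = offset d (Suc N)"
  by (simp add: total_dim_def offset_def atLeastLessThanSuc_atLeastAtMost)

lemma node_eq:
  assumes "1 \<le> i" "offset d i \<le> \<alpha>" "\<alpha> < offset d i + d i"
  shows "node d \<alpha> = i"
  unfolding node_def
proof (rule Least_equality)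
  show "\<alpha> < offset d (Suc i)" using assms by (simp add: offset_Suc)
  fix j assume "\<alpha> < offset d (Suc j)"
  then show "i \<le> j" using assms(2) offset_mono[of "Suc j" i d] by (metis leD le_trans not_less_eq_eq)
qed

lemma node_bounds:
  assumes "\<alpha> < total_dim N d"
  shows "node d \<alpha> \<in> {1..N}" "offset d (node d \<alpha>) \<le> \<alpha>" "\<alpha> < offset d (node d \<alpha>) + d (node d \<alpha>)"
proof -
  have less: "\<alpha> < offset d (Suc (node d \<alpha>))"
    unfolding node_def by (rule LeastI) (use assms in \<open>simp add: total_dim_offset\<close>)
  have "node d \<alpha> \<noteq> 0" using less by (intro notI) (simp add: offset_def)
  moreover have "node d \<alpha> \<le> N"
    unfolding node_def by (rule Least_le) (use assms in \<open>simp add: total_dim_offset\<close>)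
  ultimately show "node d \<alpha> \<in> {1..N}" by simp
  then show "\<alpha> < offset d (node d \<alpha>) + d (node d \<alpha>)" using less by (simp add: offset_Suc)
  obtain j where j: "node d \<alpha> = Suc j" using \<open>node d \<alpha> \<noteq> 0\<close> not0_implies_Suc by blast
  then have "\<not> \<alpha> < offset d (Suc j)" using not_less_Least[of j "\<lambda>i. \<alpha> < offset d (Suc i)"] by (simp add: node_def)
  then show "offset d (node d \<alpha>) \<le> \<alpha>" using j by simp
qed

lemma offset_add_less: "i \<in> {1..N} \<Longrightarrow> r < d i \<Longrightarrow> offset d i + r < total_dim N d"
  using offset_mono[of "Suc i" "Suc N" d] by (simp add: total_dim_offset offset_Suc)

text \<open>Translates vanishing blocks into vanishing entries; from here on only coordinates and
  their nodes occur.\<close>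

lemma sparse_mats_iff:
  "K \<in> sparse_mats G N d \<longleftrightarrow> K \<in> carrier_mat (total_dim N d) (total_dim N d) \<and>
    (\<forall>\<alpha><total_dim N d. \<forall>\<beta><total_dim N d. K $$ (\<alpha>, \<beta>) \<noteq> 0 \<longrightarrow>
      node d \<alpha> = node d \<beta> \<or> (node d \<alpha>, node d \<beta>) \<in> parcs G)" (is "?L \<longleftrightarrow> ?c \<and> ?R")
proof -
  have "?R" if K: "?L"
  proof (intro allI impI)
    fix \<alpha> \<beta> assume lt: "\<alpha> < total_dim N d" "\<beta> < total_dim N d" and nz: "K $$ (\<alpha>, \<beta>) \<noteq> 0"
    note a = node_bounds[OF lt(1)] and b = node_bounds[OF lt(2)]
    have "block d K (node d \<alpha>) (node d \<beta>) $$ (\<alpha> - offset d (node d \<alpha>), \<beta> - offset d (node d \<beta>)) = K $$ (\<alpha>, \<beta>)"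
      using a b by (simp add: block_def)
    then have "block d K (node d \<alpha>) (node d \<beta>) \<noteq> 0\<^sub>m (d (node d \<alpha>)) (d (node d \<beta>))"
      using nz a b by auto
    then show "node d \<alpha> = node d \<beta> \<or> (node d \<alpha>, node d \<beta>) \<in> parcs G"
      using K a(1) b(1) unfolding sparse_mats_def by blast
  qed
  moreover have "?L" if c: "?c" and R: "?R"
    unfolding sparse_mats_def
  proof (intro CollectI conjI ballI impI c)
    fix i j assume i: "i \<in> {1..N}" and j: "j \<in> {1..N}" and ij: "(i, j) \<notin> parcs G \<and> i \<noteq> j"
    show "block d K i j = 0\<^sub>m (d i) (d j)"
    proof (rule eq_matI)
      fix r s assume "r < dim_row (0\<^sub>m (d i) (d j))" "s < dim_col (0\<^sub>m (d i) (d j))"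
      then have rs: "r < d i" "s < d j" by auto
      have "node d (offset d i + r) = i" "node d (offset d j + s) = j"
        using node_eq i j rs by auto
      then have "K $$ (offset d i + r, offset d j + s) = 0"
        using R ij offset_add_less[of i N r d, OF i rs(1)] offset_add_less[of j N s d, OF j rs(2)] by metis
      then show "block d K i j $$ (r, s) = 0\<^sub>m (d i) (d j) $$ (r, s)"
        using rs by (simp add: block_def)
    qed (auto simp: block_def)
  qed
  moreover have "?c" if "?L" using that by (simp add: sparse_mats_def)
  ultimately show ?thesis by blast
qed

definition clique_rows :: "(nat \<Rightarrow> nat) \<Rightarrow> nat set \<Rightarrow> nat list" where
  "clique_rows d S = concat (map (\<lambda>j. [offset d j..<offset d j + d j]) (sorted_list_of_set S))"

lemma E_clique_sel_mat: "E_clique N d S = sel_mat (total_dim N d) (clique_rows d S)"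
proof -
  have "E_node N d j = sel_mat (total_dim N d) [offset d j..<offset d j + d j]" for j
    unfolding E_node_def sel_mat_def by (rule eq_matI) auto
  then have "E_node N d = (\<lambda>j. sel_mat (total_dim N d) [offset d j..<offset d j + d j])"
    by (rule ext)
  then show ?thesis
    by (simp only: E_clique_def clique_rows_def vstack_sel_mat)
qed

lemma clique_rows:
  assumes S: "S \<subseteq> {1..N}"
  shows "set (clique_rows d S) = {\<alpha>. \<alpha> < total_dim N d \<and> node d \<alpha> \<in> S}"
    and "distinct (clique_rows d S)" and "length (clique_rows d S) = clique_dim d S"
proof -
  have fin: "finite S" using S finite_subset by blast
  let ?I = "\<lambda>j. [offset d j..<offset d j + d j]"
  show "set (clique_rows d S) = {\<alpha>. \<alpha> < total_dim N d \<and> node d \<alpha> \<in> S}"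
  proof (rule Set.set_eqI, rule iffI)
    fix \<alpha> assume "\<alpha> \<in> set (clique_rows d S)"
    then obtain j where j: "j \<in> S" "offset d j \<le> \<alpha>" "\<alpha> < offset d j + d j"
      using fin by (auto simp: clique_rows_def)
    then have "node d \<alpha> = j" using S by (intro node_eq) auto
    moreover have "\<alpha> < total_dim N d"
      using offset_add_less[of j N "\<alpha> - offset d j" d] j S by auto
    ultimately show "\<alpha> \<in> {\<alpha>. \<alpha> < total_dim N d \<and> node d \<alpha> \<in> S}" using j by simp
  next
    fix \<alpha> assume "\<alpha> \<in> {\<alpha>. \<alpha> < total_dim N d \<and> node d \<alpha> \<in> S}"
    then show "\<alpha> \<in> set (clique_rows d S)"
      using node_bounds[of \<alpha> N d] fin by (auto simp: clique_rows_def)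
  qed
  have "distinct (concat (map ?I js))" if "distinct js" "set js \<subseteq> {1..N}" for js
    using that
  proof (induction js)
    case (Cons j js)
    have "set (?I j) \<inter> set (concat (map ?I js)) = {}"
    proof (rule ccontr)
      assume "set (?I j) \<inter> set (concat (map ?I js)) \<noteq> {}"
      then obtain \<alpha> where "\<alpha> \<in> set (?I j)" "\<alpha> \<in> set (concat (map ?I js))" by blast
      moreover from this(2) obtain l where "l \<in> set js" "\<alpha> \<in> set (?I l)" by auto
      ultimately have l: "l \<in> set js" "\<alpha> \<in> set (?I j)" "\<alpha> \<in> set (?I l)" by blast+
      have "node d \<alpha> = j" using l Cons.prems by (intro node_eq) auto
      moreover have "node d \<alpha> = l" using l Cons.prems by (intro node_eq) auto
      ultimately show False using l Cons.prems by simp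
    qed
    then show ?case using Cons by simp
  qed simp
  then show "distinct (clique_rows d S)"
    unfolding clique_rows_def using S fin by simp
  have "length (clique_rows d S) = sum_list (map d (sorted_list_of_set S))"
    by (simp add: clique_rows_def length_concat comp_def)
  also have "\<dots> = clique_dim d S"
    unfolding clique_dim_def using fin by (simp add: sum_list_distinct_conv_sum_set)
  finally show "length (clique_rows d S) = clique_dim d S" .
qed

section \<open>Families of cliques covering exactly the nodes and edges\<close>

locale clique_cover =
  fixes G :: "nat pair_pre_digraph" and N q :: nat and d :: "nat \<Rightarrow> nat" and C :: "nat \<Rightarrow> nat set"
  assumes graph: "pair_graph G" and verts: "pverts G = {1..N}"
    and cliques: "\<And>k. k \<in> {1..q} \<Longrightarrow> is_clique G (C k)"
    and covered: "\<And>i. i \<in> {1..N} \<Longrightarrow> clique_indices q C i \<noteq> {}"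
    and edge_iff: "\<And>i j. i \<in> {1..N} \<Longrightarrow> j \<in> {1..N} \<Longrightarrow> i \<noteq> j \<Longrightarrow>
      clique_indices q C i \<inter> clique_indices q C j \<noteq> {} \<longleftrightarrow> (i, j) \<in> parcs G"
begin

abbreviation "n \<equiv> total_dim N d"
abbreviation "E \<equiv> E_mat N d q C"
abbreviation "F \<equiv> minv (transpose_mat E * E) * transpose_mat E"
abbreviation "sel k \<equiv> sel_mat n (clique_rows d (C k))"
abbreviation "dim_at k \<equiv> clique_dim d (C k)"
definition "m = sum_list (map dim_at [1..<Suc q])"
text \<open>The multiplicity of a coordinate among the rows of \<open>E\<close>, which becomes the
  diagonal of the Gram matrix.\<close>

definition "cnt \<alpha> = real (card (clique_indices q C (node d \<alpha>)))"

lemma C_sub: "k \<in> {1..q} \<Longrightarrow> C k \<subseteq> {1..N}"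
  using cliques verts by (auto simp: is_clique_def)

lemmas rows = clique_rows[OF C_sub, where d = d]

lemma sel_carrier: "k \<in> {1..q} \<Longrightarrow> sel k \<in> carrier_mat (dim_at k) n"
  using sel_mat_carrier[of n "clique_rows d (C k)"] rows(3)[of k] by simp

lemma in_upt: "k \<in> set [1..<Suc q] \<Longrightarrow> k \<in> {1..q}"
  by auto

lemma E_eq: "E = vstack n (map sel [1..<Suc q])"
  unfolding E_mat_def E_clique_sel_mat ..

lemma E_carrier: "E \<in> carrier_mat m n"
  unfolding E_eq m_def by (rule vstack_carrier[where m = dim_at]) (rule sel_carrier, erule in_upt)

section \<open>Algebra of block-diagonal matrices\<close>

lemma blkdiag_carrier:
  assumes "\<And>k. k \<in> {1..q} \<Longrightarrow> P k \<in> carrier_mat (dim_at k) (dim_at k)"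
  shows "blkdiag q P \<in> carrier_mat m m"
  unfolding blkdiag_def m_def
  by (rule diag_block_carrier[where m = dim_at]) (rule assms, erule in_upt)

lemma DD_carrier: "D \<in> DD d q C \<Longrightarrow> D \<in> carrier_mat m m"
  unfolding DD_def using blkdiag_carrier by blast

lemma DDpp_subset_DD: "DDpp d q C \<subseteq> DD d q C"
  unfolding DD_def DDpp_def by blast

lemma blkdiag_mult:
  assumes "\<forall>k\<in>{1..q}. P k \<in> carrier_mat (dim_at k) (dim_at k)"
    and "\<forall>k\<in>{1..q}. R k \<in> carrier_mat (dim_at k) (dim_at k)"
  shows "blkdiag q P * blkdiag q R = blkdiag q (\<lambda>k. P k * R k)"
  unfolding blkdiag_def
  by (rule diag_block_mat_mult[where m = dim_at]) (use assms in_upt in blast)+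

lemma DD_mult:
  assumes "D1 \<in> DD d q C" "D2 \<in> DD d q C"
  shows "D1 * D2 \<in> DD d q C"
proof -
  obtain P R where P: "D1 = blkdiag q P" "\<And>k. k \<in> {1..q} \<Longrightarrow> P k \<in> carrier_mat (dim_at k) (dim_at k)"
    and R: "D2 = blkdiag q R" "\<And>k. k \<in> {1..q} \<Longrightarrow> R k \<in> carrier_mat (dim_at k) (dim_at k)"
    using assms unfolding DD_def by auto
  have "D1 * D2 = blkdiag q (\<lambda>k. P k * R k)" unfolding P(1) R(1) using P(2) R(2) by (intro blkdiag_mult) auto
  moreover have "P k * R k \<in> carrier_mat (dim_at k) (dim_at k)" if "k \<in> {1..q}" for k
    by (rule mult_carrier_mat[OF P(2)[OF that] R(2)[OF that]])
  ultimately show ?thesis unfolding DD_def by blast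
qed

lemma blkdiag_one: "blkdiag q (\<lambda>k. 1\<^sub>m (dim_at k)) = 1\<^sub>m m"
  unfolding blkdiag_def m_def by (rule diag_block_mat_one)

lemma DDpp_pos_def:
  assumes "Q \<in> DDpp d q C"
  shows "pos_def Q"
proof -
  obtain P where P: "Q = blkdiag q P"
    "\<And>k. k \<in> {1..q} \<Longrightarrow> P k \<in> carrier_mat (dim_at k) (dim_at k)" "\<And>k. k \<in> {1..q} \<Longrightarrow> pos_def (P k)"
    using assms unfolding DDpp_def by auto
  show ?thesis unfolding P(1) blkdiag_def
    by (rule diag_block_mat_pos_def[where m = dim_at]; rule P; erule in_upt)
qed

lemma DDpp_inverse:
  assumes "Q \<in> DDpp d q C"
  obtains W where "W \<in> DDpp d q C" "Q * W = 1\<^sub>m m" "W * Q = 1\<^sub>m m"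
proof -
  obtain P where P: "Q = blkdiag q P"
    "\<And>k. k \<in> {1..q} \<Longrightarrow> P k \<in> carrier_mat (dim_at k) (dim_at k)" "\<And>k. k \<in> {1..q} \<Longrightarrow> pos_def (P k)"
    using assms unfolding DDpp_def by auto
  have "\<exists>Y. Y \<in> carrier_mat (dim_at k) (dim_at k) \<and> P k * Y = 1\<^sub>m (dim_at k) \<and> Y * P k = 1\<^sub>m (dim_at k) \<and> pos_def Y"
    if "k \<in> {1..q}" for k
    using pos_def_inverse[OF P(2)[OF that] P(3)[OF that]] by metis
  then obtain Y where Y: "\<And>k. k \<in> {1..q} \<Longrightarrow> Y k \<in> carrier_mat (dim_at k) (dim_at k)"
    "\<And>k. k \<in> {1..q} \<Longrightarrow> P k * Y k = 1\<^sub>m (dim_at k)" "\<And>k. k \<in> {1..q} \<Longrightarrow> Y k * P k = 1\<^sub>m (dim_at k)"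
    "\<And>k. k \<in> {1..q} \<Longrightarrow> pos_def (Y k)"
    by metis
  have cong: "blkdiag q X = 1\<^sub>m m" if "\<And>k. k \<in> {1..q} \<Longrightarrow> X k = 1\<^sub>m (dim_at k)" for X
  proof -
    have "map X [1..<Suc q] = map (\<lambda>k. 1\<^sub>m (dim_at k)) [1..<Suc q]"
      by (intro map_cong refl that) (erule in_upt)
    then show ?thesis using blkdiag_one by (simp only: blkdiag_def)
  qed
  have "Q * blkdiag q Y = 1\<^sub>m m" "blkdiag q Y * Q = 1\<^sub>m m"
    using blkdiag_mult[of P Y] blkdiag_mult[of Y P] P(2) Y(1)
      cong[of "\<lambda>k. P k * Y k", OF Y(2)] cong[of "\<lambda>k. Y k * P k", OF Y(3)]
    by (simp_all add: P(1))
  moreover have "blkdiag q Y \<in> DDpp d q C" unfolding DDpp_def using Y(1,4) by blast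
  ultimately show thesis using that by blast
qed

lemma congruence_entry:
  assumes P: "\<forall>k\<in>{1..q}. P k \<in> carrier_mat (dim_at k) (dim_at k)" and lt: "\<alpha> < n" "\<beta> < n"
  shows "(transpose_mat E * blkdiag q P * E) $$ (\<alpha>, \<beta>) =
    (\<Sum>k\<in>{1..q}. (transpose_mat (sel k) * P k * sel k) $$ (\<alpha>, \<beta>))"
proof -
  have "(transpose_mat E * blkdiag q P * E) $$ (\<alpha>, \<beta>) =
      sum_list (map (\<lambda>k. (transpose_mat (sel k) * P k * sel k) $$ (\<alpha>, \<beta>)) [1..<Suc q])"
    unfolding E_eq blkdiag_def
    by (rule vstack_diag_congruence[where m = dim_at, OF _ _ lt]) (use P in_upt sel_carrier in blast)+
  then show ?thesis by (simp only: sum_list_Suc_upt)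
qed

lemma congruence_carrier: "D \<in> carrier_mat m m \<Longrightarrow> transpose_mat E * D * E \<in> carrier_mat n n"
  by (rule mult_carrier_mat[OF mult_carrier_mat E_carrier]) (use E_carrier in auto)

text \<open>The assumptions on the cliques in the form used for entries: the admissible positions
  are those seen by some clique. Equal nodes are handled by \<open>covered\<close>, distinct ones by
  \<open>edge_iff\<close>.\<close>

lemma linked_iff:
  assumes "\<alpha> < n" "\<beta> < n"
  shows "(\<exists>k\<in>{1..q}. node d \<alpha> \<in> C k \<and> node d \<beta> \<in> C k) \<longleftrightarrow>
    node d \<alpha> = node d \<beta> \<or> (node d \<alpha>, node d \<beta>) \<in> parcs G"
proof (cases "node d \<alpha> = node d \<beta>")
  case True
  then show ?thesis using covered[OF node_bounds(1)[OF assms(2)]] by (auto simp: clique_indices_def)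
next
  case False
  then show ?thesis
    using edge_iff[OF node_bounds(1)[OF assms(1)] node_bounds(1)[OF assms(2)] False]
    by (auto simp: clique_indices_def)
qed

text \<open>A nonzero entry needs a nonzero contribution from some clique, which then contains both
  nodes.\<close>

lemma DD_congruence_sparse:
  assumes "D \<in> DD d q C"
  shows "transpose_mat E * D * E \<in> sparse_mats G N d"
proof -
  obtain P where P: "D = blkdiag q P" "\<And>k. k \<in> {1..q} \<Longrightarrow> P k \<in> carrier_mat (dim_at k) (dim_at k)"
    using assms unfolding DD_def by auto
  have "node d \<alpha> = node d \<beta> \<or> (node d \<alpha>, node d \<beta>) \<in> parcs G"
    if lt: "\<alpha> < n" "\<beta> < n" and nz: "(transpose_mat E * D * E) $$ (\<alpha>, \<beta>) \<noteq> 0" for \<alpha> \<beta>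
  proof -
    have "(\<Sum>k\<in>{1..q}. (transpose_mat (sel k) * P k * sel k) $$ (\<alpha>, \<beta>)) \<noteq> 0"
      using nz congruence_entry[of P, OF _ lt] P(2) unfolding P(1) by simp
    then obtain k where k: "k \<in> {1..q}" "(transpose_mat (sel k) * P k * sel k) $$ (\<alpha>, \<beta>) \<noteq> 0"
      by (rule sum.not_neutral_contains_not_neutral)
    then have "\<alpha> \<in> set (clique_rows d (C k)) \<and> \<beta> \<in> set (clique_rows d (C k))"
      using sel_mat_congruence_support[of "P k" "clique_rows d (C k)" \<alpha> n \<beta>] P(2) lt rows(3) by simp
    then show ?thesis using linked_iff[OF lt] rows(1)[OF k(1)] k(1) by auto
  qed
  then show ?thesis
    unfolding sparse_mats_iff using congruence_carrier[OF DD_carrier[OF assms]] by blast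
qed

section \<open>The Gram matrix of the stack and its inverse\<close>

lemma sel_gram:
  assumes "k \<in> {1..q}"
  shows "transpose_mat (sel k) * sel k = mat_diag n (\<lambda>\<alpha>. if \<alpha> \<in> set (clique_rows d (C k)) then 1 else 0)"
  by (rule sel_mat_gram) (use rows[OF assms] in auto)

lemma gram_entry:
  assumes lt: "\<alpha> < n" "\<beta> < n"
  shows "(transpose_mat E * E) $$ (\<alpha>, \<beta>) = (\<Sum>k\<in>{1..q}. (transpose_mat (sel k) * sel k) $$ (\<alpha>, \<beta>))"
proof -
  have "transpose_mat E * E = transpose_mat E * blkdiag q (\<lambda>k. 1\<^sub>m (dim_at k)) * E"
    unfolding blkdiag_one using E_carrier by simp
  then have "(transpose_mat E * E) $$ (\<alpha>, \<beta>) =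
      (\<Sum>k\<in>{1..q}. (transpose_mat (sel k) * 1\<^sub>m (dim_at k) * sel k) $$ (\<alpha>, \<beta>))"
    using congruence_entry[of "\<lambda>k. 1\<^sub>m (dim_at k)", OF _ lt] by simp
  also have "\<dots> = (\<Sum>k\<in>{1..q}. (transpose_mat (sel k) * sel k) $$ (\<alpha>, \<beta>))"
  proof (rule sum.cong)
    fix k assume "k \<in> {1..q}"
    then have "transpose_mat (sel k) * 1\<^sub>m (dim_at k) = transpose_mat (sel k)"
      by (intro right_mult_one_mat) (use sel_carrier in auto)
    then show "(transpose_mat (sel k) * 1\<^sub>m (dim_at k) * sel k) $$ (\<alpha>, \<beta>) =
        (transpose_mat (sel k) * sel k) $$ (\<alpha>, \<beta>)"
      by simp
  qed simp
  finally show ?thesis .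
qed

lemma gram_eq: "transpose_mat E * E = mat_diag n cnt"
proof (rule eq_matI)
  fix \<alpha> \<beta> assume "\<alpha> < dim_row (mat_diag n cnt)" "\<beta> < dim_col (mat_diag n cnt)"
  then have lt: "\<alpha> < n" "\<beta> < n" by (auto simp: mat_diag_def)
  let ?I = "clique_indices q C (node d \<alpha>)"
  have "(transpose_mat E * E) $$ (\<alpha>, \<beta>) = (\<Sum>k\<in>{1..q}. if k \<in> ?I then (if \<alpha> = \<beta> then 1 else 0) else 0)"
    unfolding gram_entry[OF lt]
  proof (rule sum.cong)
    fix k assume k: "k \<in> {1..q}"
    show "(transpose_mat (sel k) * sel k) $$ (\<alpha>, \<beta>) = (if k \<in> ?I then (if \<alpha> = \<beta> then 1 else 0) else 0)"
      using k lt rows(1)[OF k] by (auto simp: sel_gram mat_diag_def clique_indices_def)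
  qed simp
  also have "\<dots> = (\<Sum>k\<in>?I. if \<alpha> = \<beta> then 1 else 0)"
  proof -
    have "{1..q} \<inter> ?I = ?I"
      by (auto simp: clique_indices_def)
    then show ?thesis by (subst sum.inter_restrict[symmetric]) simp_all
  qed
  also have "\<dots> = mat_diag n cnt $$ (\<alpha>, \<beta>)"
    using lt by (simp add: mat_diag_def cnt_def)
  finally show "(transpose_mat E * E) $$ (\<alpha>, \<beta>) = mat_diag n cnt $$ (\<alpha>, \<beta>)" .
qed (use E_carrier in \<open>auto simp: mat_diag_def\<close>)

lemma cnt_pos: "\<alpha> < n \<Longrightarrow> 0 < cnt \<alpha>"
  using covered[OF node_bounds(1)] by (auto simp: cnt_def card_gt_0_iff clique_indices_def)

lemma gram_inverse: "minv (transpose_mat E * E) = mat_diag n (\<lambda>\<alpha>. 1 / cnt \<alpha>)"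
proof -
  have 1: "mat_diag n (\<lambda>\<alpha>. cnt \<alpha> * (1 / cnt \<alpha>)) = 1\<^sub>m n"
    by (rule eq_matI) (use cnt_pos in \<open>auto simp: mat_diag_def less_imp_neq[symmetric]\<close>)
  then have 2: "mat_diag n (\<lambda>\<alpha>. 1 / cnt \<alpha> * cnt \<alpha>) = 1\<^sub>m n"
    by (simp add: mult.commute)
  show ?thesis
    unfolding gram_eq
    by (rule minv_eq[OF mat_diag_dim mat_diag_dim]) (simp_all only: mat_diag_diag 1 2)
qed

lemma gram_inverse_props:
  shows "minv (transpose_mat E * E) \<in> carrier_mat n n"
    and "transpose_mat (minv (transpose_mat E * E)) = minv (transpose_mat E * E)"
    and "F \<in> carrier_mat n m" and "F * E = 1\<^sub>m n"
proof -
  show c: "minv (transpose_mat E * E) \<in> carrier_mat n n" unfolding gram_inverse by simp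
  show "transpose_mat (minv (transpose_mat E * E)) = minv (transpose_mat E * E)"
    unfolding gram_inverse by (rule eq_matI) (auto simp: mat_diag_def)
  show "F \<in> carrier_mat n m" by (rule mult_carrier_mat[OF c]) (use E_carrier in simp)
  have "F * E = minv (transpose_mat E * E) * (transpose_mat E * E)"
    by (rule assoc_mult_mat[OF c]) (use E_carrier in auto)
  also have "\<dots> = mat_diag n (\<lambda>\<alpha>. 1 / cnt \<alpha> * cnt \<alpha>)"
    unfolding gram_inverse unfolding gram_eq by (rule mat_diag_diag)
  also have "\<dots> = 1\<^sub>m n"
    by (rule eq_matI) (use cnt_pos in \<open>auto simp: mat_diag_def less_imp_neq[symmetric]\<close>)
  finally show "F * E = 1\<^sub>m n" .
qed

text \<open>Separates the left inverse into a row scaling, harmless for sparsity, and the symmetric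
  congruence by \<open>E\<close>.\<close>

lemma F_congruence:
  assumes D: "D \<in> carrier_mat m m"
  shows "F * D * E = mat_diag n (\<lambda>\<alpha>. 1 / cnt \<alpha>) * (transpose_mat E * D * E)"
proof -
  let ?Gi = "minv (transpose_mat E * E)"
  have Gi: "?Gi \<in> carrier_mat n n" by (rule gram_inverse_props)
  have ET: "transpose_mat E \<in> carrier_mat n m" using E_carrier by simp
  have "F * D * E = ?Gi * (transpose_mat E * D) * E"
    unfolding assoc_mult_mat[OF Gi ET D] ..
  also have "\<dots> = ?Gi * (transpose_mat E * D * E)"
    by (rule assoc_mult_mat[OF Gi mult_carrier_mat[OF ET D] E_carrier])
  finally show ?thesis unfolding gram_inverse .
qed

lemma mat_diag_mult_sparse:
  assumes "K \<in> sparse_mats G N d"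
  shows "mat_diag n f * K \<in> sparse_mats G N d"
proof -
  have "K \<in> carrier_mat n n" using assms by (simp add: sparse_mats_iff)
  then show ?thesis
    using assms unfolding mat_diag_mult_left[OF \<open>K \<in> carrier_mat n n\<close>] by (simp add: sparse_mats_iff)
qed

section \<open>Decomposing sparse matrices into clique blocks\<close>

lemma restrict_supported:
  assumes k: "k \<in> {1..q}" and X: "X \<in> carrier_mat n n"
    and supp: "\<forall>\<alpha><n. \<forall>\<beta><n. X $$ (\<alpha>, \<beta>) \<noteq> 0 \<longrightarrow> node d \<alpha> \<in> C k \<and> node d \<beta> \<in> C k"
  shows "sel k * X * transpose_mat (sel k) \<in> carrier_mat (dim_at k) (dim_at k)"
    and "transpose_mat (sel k) * (sel k * X * transpose_mat (sel k)) * sel k = X"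
proof -
  show "sel k * X * transpose_mat (sel k) \<in> carrier_mat (dim_at k) (dim_at k)"
    by (rule mult_carrier_mat[OF mult_carrier_mat[OF sel_carrier[OF k] X]])
      (use sel_carrier[OF k] in simp)
  show "transpose_mat (sel k) * (sel k * X * transpose_mat (sel k)) * sel k = X"
    by (rule sel_mat_restrict_extend) (use rows[OF k] X supp in auto)
qed

lemma sparse_decompose:
  assumes "K \<in> sparse_mats G N d"
  obtains D where "D \<in> DD d q C" "transpose_mat E * D * E = K"
proof -
  have K: "K \<in> carrier_mat n n"
    and sp: "\<And>\<alpha> \<beta>. \<alpha> < n \<Longrightarrow> \<beta> < n \<Longrightarrow> K $$ (\<alpha>, \<beta>) \<noteq> 0 \<Longrightarrow> \<exists>k\<in>{1..q}. node d \<alpha> \<in> C k \<and> node d \<beta> \<in> C k"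
    using assms linked_iff unfolding sparse_mats_iff by blast+
  \<comment> \<open>One clique is chosen per entry, so that an entry seen by several cliques is
    counted once.\<close>
  define \<kappa> where "\<kappa> \<alpha> \<beta> = (SOME k. k \<in> {1..q} \<and> node d \<alpha> \<in> C k \<and> node d \<beta> \<in> C k)" for \<alpha> \<beta>
  have \<kappa>: "\<kappa> \<alpha> \<beta> \<in> {1..q}" "node d \<alpha> \<in> C (\<kappa> \<alpha> \<beta>)" "node d \<beta> \<in> C (\<kappa> \<alpha> \<beta>)"
    if "\<alpha> < n" "\<beta> < n" "K $$ (\<alpha>, \<beta>) \<noteq> 0" for \<alpha> \<beta>
    using someI_ex[of "\<lambda>k. k \<in> {1..q} \<and> node d \<alpha> \<in> C k \<and> node d \<beta> \<in> C k"] sp[OF that]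
    unfolding \<kappa>_def by blast+
  define X where "X k = mat n n (\<lambda>(\<alpha>, \<beta>). if k = \<kappa> \<alpha> \<beta> then K $$ (\<alpha>, \<beta>) else 0)" for k
  have X: "X k \<in> carrier_mat n n" for k by (simp add: X_def)
  have supp: "\<forall>\<alpha><n. \<forall>\<beta><n. X k $$ (\<alpha>, \<beta>) \<noteq> 0 \<longrightarrow> node d \<alpha> \<in> C k \<and> node d \<beta> \<in> C k" for k
    using \<kappa> by (auto simp: X_def)
  note S = restrict_supported[OF _ X supp]
  let ?P = "\<lambda>k. sel k * X k * transpose_mat (sel k)"
  have D: "blkdiag q ?P \<in> DD d q C" unfolding DD_def using S(1) by blast
  moreover have "transpose_mat E * blkdiag q ?P * E = K"
  proof (rule eq_matI)
    fix \<alpha> \<beta> assume "\<alpha> < dim_row K" "\<beta> < dim_col K"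
    then have lt: "\<alpha> < n" "\<beta> < n" using K by auto
    have "(transpose_mat E * blkdiag q ?P * E) $$ (\<alpha>, \<beta>) = (\<Sum>k\<in>{1..q}. X k $$ (\<alpha>, \<beta>))"
      using congruence_entry[of ?P, OF _ lt] S by simp
    also have "\<dots> = (\<Sum>k\<in>{1..q}. if k = \<kappa> \<alpha> \<beta> then K $$ (\<alpha>, \<beta>) else 0)"
      using lt by (intro sum.cong) (auto simp: X_def)
    \<comment> \<open>At a zero entry the chosen index may lie outside \<open>{1..q}\<close>, but
      then both sides are 0.\<close>
    also have "\<dots> = K $$ (\<alpha>, \<beta>)" using \<kappa>(1)[OF lt] by (cases "K $$ (\<alpha>, \<beta>) = 0") auto
    finally show "(transpose_mat E * blkdiag q ?P * E) $$ (\<alpha>, \<beta>) = K $$ (\<alpha>, \<beta>)" .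
  qed (use K congruence_carrier[OF DD_carrier[OF D]] in auto)
  ultimately show thesis by (rule that)
qed

lemma sparse_iff_congruence:
  "K \<in> sparse_mats G N d \<longleftrightarrow> (\<exists>D\<in>DD d q C. K = F * D * E)"
proof
  assume K: "K \<in> sparse_mats G N d"
  \<comment> \<open>The rescaled matrix is decomposed in place of \<open>K\<close>, so that the
    factor \<open>1 / cnt \<alpha>\<close> from \<open>F\<close> cancels.\<close>
  then obtain D where D: "D \<in> DD d q C" "transpose_mat E * D * E = mat_diag n cnt * K"
    using sparse_decompose[OF mat_diag_mult_sparse[OF K, of cnt]] by metis
  have Kc: "K \<in> carrier_mat n n" using K by (simp add: sparse_mats_iff)
  have 1: "mat_diag n (\<lambda>\<alpha>. 1 / cnt \<alpha> * cnt \<alpha>) = 1\<^sub>m n"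
    by (rule eq_matI) (use cnt_pos in \<open>auto simp: mat_diag_def less_imp_neq[symmetric]\<close>)
  have "F * D * E = mat_diag n (\<lambda>\<alpha>. 1 / cnt \<alpha>) * (mat_diag n cnt * K)"
    unfolding F_congruence[OF DD_carrier[OF D(1)]] D(2) ..
  also have "\<dots> = mat_diag n (\<lambda>\<alpha>. 1 / cnt \<alpha>) * mat_diag n cnt * K"
    by (rule assoc_mult_mat[OF mat_diag_dim mat_diag_dim Kc, symmetric])
  also have "\<dots> = K" unfolding mat_diag_diag 1 using Kc by simp
  finally show "\<exists>D\<in>DD d q C. K = F * D * E" using D(1) by auto
next
  assume "\<exists>D\<in>DD d q C. K = F * D * E"
  then show "K \<in> sparse_mats G N d"
    using F_congruence[OF DD_carrier] mat_diag_mult_sparse[OF DD_congruence_sparse] by metis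
qed

text \<open>\<open>E\<close> is injective because \<open>F\<close> is a left inverse, so
  definiteness survives the congruence.\<close>

lemma congruence_pos_def:
  assumes W: "W \<in> DDpp d q C"
  shows "pos_def (transpose_mat E * W * E)"
proof -
  have Wc: "W \<in> carrier_mat m m" using W DDpp_subset_DD DD_carrier by blast
  have ET: "transpose_mat E \<in> carrier_mat n m" using E_carrier by simp
  note EW = mult_carrier_mat[OF ET Wc]
  note WT = pos_defD(1)[OF DDpp_pos_def[OF W] Wc]
  show ?thesis
  proof (rule pos_defI[OF congruence_carrier[OF Wc]])
    show "transpose_mat (transpose_mat E * W * E) = transpose_mat E * W * E"
      unfolding transpose_mult[OF EW E_carrier] transpose_mult[OF ET Wc] WT transpose_transpose
      by (rule assoc_mult_mat[OF ET Wc E_carrier, symmetric])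
    fix x :: "real vec" assume x: "x \<in> carrier_vec n" "x \<noteq> 0\<^sub>v n"
    have Ex: "E *\<^sub>v x \<in> carrier_vec m" using E_carrier x by simp
    have "F *\<^sub>v (E *\<^sub>v x) = x"
      using assoc_mult_mat_vec[OF gram_inverse_props(3) E_carrier x(1)] gram_inverse_props(4) x by simp
    then have "E *\<^sub>v x \<noteq> 0\<^sub>v m" using x mult_mat_zero_vec[OF gram_inverse_props(3)] by metis
    then have "0 < (E *\<^sub>v x) \<bullet> (W *\<^sub>v (E *\<^sub>v x))"
      by (rule pos_defD(2)[OF DDpp_pos_def[OF W] Wc Ex])
    also have "\<dots> = x \<bullet> ((transpose_mat E * W * E) *\<^sub>v x)"
      unfolding assoc_mult_mat_vec[OF EW E_carrier x(1)] assoc_mult_mat_vec[OF ET Wc Ex]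
      using transpose_move[OF ET x(1), of "W *\<^sub>v (E *\<^sub>v x)"] Wc Ex by simp
    finally show "0 < x \<bullet> ((transpose_mat E * W * E) *\<^sub>v x)" .
  qed
qed

text \<open>There are finitely many cliques, so each one lies below a maximal one.\<close>

lemma clique_in_cover:
  assumes max: "C ` {1..q} = {S. is_maximal_clique G S}" and X: "is_clique G X"
  shows "\<exists>k\<in>{1..q}. X \<subseteq> C k"
proof -
  have "finite {S. is_clique G S}"
    by (rule finite_subset[of _ "Pow {1..N}"]) (auto simp: is_clique_def verts)
  then obtain S where S: "is_clique G S" "X \<subseteq> S" "\<And>T. is_clique G T \<Longrightarrow> S \<subseteq> T \<Longrightarrow> S = T"
    using finite_has_maximal2[of "{S. is_clique G S}" X] X by auto
  then have "is_maximal_clique G S" unfolding is_maximal_clique_def by blast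
  then have "S \<in> C ` {1..q}" by (simp only: max mem_Collect_eq)
  then show ?thesis using S(2) by auto
qed

lemma qform_mat:
  assumes "X \<in> carrier_mat n n" "v \<in> carrier_vec n"
  shows "v \<bullet> (X *\<^sub>v v) = qform {..<n} (\<lambda>\<alpha> \<beta>. X $$ (\<alpha>, \<beta>)) (($) v)"
  unfolding qform_def using scalar_prod_mat_vec_sum[OF assms(1,2,2)] .

text \<open>
  Splitting off a small multiple of \<open>E\<^sup>T E\<close> makes the blocks positive definite rather than just
  semidefinite.
\<close>

lemma pos_def_decompose:
  assumes ch: "chordal G" and max: "C ` {1..q} = {S. is_maximal_clique G S}"
    and P: "P \<in> sparse_mats G N d" "pos_def P"
  obtains W where "W \<in> DDpp d q C" "transpose_mat E * W * E = P"
proof -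
  have Pc: "P \<in> carrier_mat n n" using P by (simp add: sparse_mats_iff)
  have gc: "transpose_mat E * E \<in> carrier_mat n n" unfolding gram_eq by simp
  obtain c where c: "0 < c" "\<And>v. v \<in> carrier_vec n \<Longrightarrow> c * (v \<bullet> v) \<le> v \<bullet> (P *\<^sub>v v)"
    using pos_def_coercive[OF Pc P(2)] by blast
  obtain b where b: "0 \<le> b" "\<And>v. v \<in> carrier_vec n \<Longrightarrow> \<bar>v \<bullet> ((transpose_mat E * E) *\<^sub>v v)\<bar> \<le> b * (v \<bullet> v)"
    using quadratic_form_bound[OF gc] by blast
  \<comment> \<open>Chosen with \<open>\<epsilon> * b \<le> c\<close>: the coercivity constant of
    \<open>P\<close> then outweighs what is subtracted. Adding 1 covers
    \<open>b = 0\<close>.\<close>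
  define \<epsilon> where "\<epsilon> = c / (b + 1)"
  have \<epsilon>: "0 < \<epsilon>" "\<epsilon> * b \<le> c" using b c by (auto simp: \<epsilon>_def field_simps)
  \<comment> \<open>The matrix \<open>P\<close> minus the multiple of the Gram matrix, extended by
    zero because the decomposition speaks of total functions supported on the index set.\<close>
  define R where "R \<alpha> \<beta> = (if \<alpha> < n \<and> \<beta> < n then P $$ (\<alpha>, \<beta>) - \<epsilon> * mat_diag n cnt $$ (\<alpha>, \<beta>) else 0)" for \<alpha> \<beta>
  have "psd_on {..<n} R"
    unfolding psd_on_def
  proof (intro conjI allI)
    have "P $$ (\<alpha>, \<beta>) = P $$ (\<beta>, \<alpha>)" if "\<alpha> < n" "\<beta> < n" for \<alpha> \<beta>
      using pos_defD(1)[OF P(2) Pc] that Pc by (metis carrier_matD index_transpose_mat(1))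
    then show "R \<alpha> \<beta> = R \<beta> \<alpha>" for \<alpha> \<beta> by (auto simp: R_def mat_diag_def)
    fix x :: "nat \<Rightarrow> real"
    define v where "v = vec n x"
    have v: "v \<in> carrier_vec n" by (simp add: v_def)
    have "qform {..<n} R x = qform {..<n} (\<lambda>\<alpha> \<beta>. P $$ (\<alpha>, \<beta>)) (($) v) - \<epsilon> * qform {..<n} (\<lambda>\<alpha> \<beta>. mat_diag n cnt $$ (\<alpha>, \<beta>)) (($) v)"
      unfolding qform_def sum_distrib_left sum_subtractf[symmetric]
      by (intro sum.cong refl) (auto simp: R_def v_def algebra_simps)
    also have "\<dots> = v \<bullet> (P *\<^sub>v v) - \<epsilon> * (v \<bullet> ((transpose_mat E * E) *\<^sub>v v))"
      unfolding qform_mat[OF Pc v] qform_mat[OF gc v] unfolding gram_eq ..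
    also have "\<dots> \<ge> 0"
    proof -
      have "\<epsilon> * (v \<bullet> ((transpose_mat E * E) *\<^sub>v v)) \<le> \<epsilon> * (b * (v \<bullet> v))"
        using b(2)[OF v] \<epsilon>(1) by (intro mult_left_mono) auto
      also have "\<dots> = (\<epsilon> * b) * (v \<bullet> v)" by simp
      also have "\<dots> \<le> c * (v \<bullet> v)"
        by (rule mult_right_mono[OF \<epsilon>(2) scalar_prod_self_nonneg])
      finally show ?thesis using c(2)[OF v] by linarith
    qed
    finally show "0 \<le> qform {..<n} R x" .
  qed
  moreover have "\<alpha> \<in> {..<n} \<and> \<beta> \<in> {..<n} \<and> (node d \<alpha> = node d \<beta> \<or> (node d \<alpha>, node d \<beta>) \<in> parcs G)"
    if "R \<alpha> \<beta> \<noteq> 0" for \<alpha> \<beta>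
  proof -
    have lt: "\<alpha> < n" "\<beta> < n" using that by (auto simp: R_def split: if_splits)
    \<comment> \<open>The Gram matrix is diagonal, so the subtraction respects the sparsity
      pattern.\<close>
    have "R \<alpha> \<beta> = 0" if "P $$ (\<alpha>, \<beta>) = 0" "\<alpha> \<noteq> \<beta>"
      using lt that by (simp add: R_def mat_diag_def)
    then have "P $$ (\<alpha>, \<beta>) \<noteq> 0 \<or> \<alpha> = \<beta>" using that by blast
    then show ?thesis using P(1) lt unfolding sparse_mats_iff by auto
  qed
  moreover have "node d ` {..<n} \<subseteq> pverts G" using node_bounds(1) verts by auto
  ultimately obtain V where
    V: "\<And>k. k \<in> {1..q} \<Longrightarrow> psd_on {..<n} (V k)"
    "\<And>k \<alpha> \<beta>. k \<in> {1..q} \<Longrightarrow> V k \<alpha> \<beta> \<noteq> 0 \<Longrightarrow> node d \<alpha> \<in> C k \<and> node d \<beta> \<in> C k"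
    "\<And>\<alpha> \<beta>. R \<alpha> \<beta> = (\<Sum>k\<in>{1..q}. V k \<alpha> \<beta>)"
    using psd_chordal_decomposition[OF graph ch finite_lessThan finite_atLeastAtMost
        clique_in_cover[OF max] subset_refl, of "node d" n R] by blast
  define X where "X k = mat n n (\<lambda>(\<alpha>, \<beta>). V k \<alpha> \<beta>)" for k
  have X: "X k \<in> carrier_mat n n" for k by (simp add: X_def)
  have supp: "\<forall>\<alpha><n. \<forall>\<beta><n. X k $$ (\<alpha>, \<beta>) \<noteq> 0 \<longrightarrow> node d \<alpha> \<in> C k \<and> node d \<beta> \<in> C k"
    if "k \<in> {1..q}" for k
    using V(2)[OF that] by (auto simp: X_def)
  note S = restrict_supported[OF _ X supp]
  define Y where "Y k = sel k * X k * transpose_mat (sel k)" for k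
  define W where "W k = Y k + \<epsilon> \<cdot>\<^sub>m 1\<^sub>m (dim_at k)" for k
  have Y: "Y k \<in> carrier_mat (dim_at k) (dim_at k)" if "k \<in> {1..q}" for k
    unfolding Y_def using S(1) that by blast
  have W: "W k \<in> carrier_mat (dim_at k) (dim_at k)" if "k \<in> {1..q}" for k
    using Y[OF that] by (simp add: W_def)
  have W_pd: "pos_def (W k)" if k: "k \<in> {1..q}" for k
  proof (rule pos_defI[OF W[OF k]])
    let ?T = "transpose_mat (sel k)"
    have s: "sel k \<in> carrier_mat (dim_at k) n" and T: "?T \<in> carrier_mat n (dim_at k)"
      using sel_carrier[OF k] by auto
    have sX: "sel k * X k \<in> carrier_mat (dim_at k) n" by (rule mult_carrier_mat[OF s X])
    have XT: "transpose_mat (X k) = X k"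
      using V(1)[OF k] by (intro eq_matI) (auto simp: X_def psd_on_def)
    have "transpose_mat (Y k) = Y k"
      unfolding Y_def transpose_mult[OF sX T] transpose_mult[OF s X] XT transpose_transpose
      by (rule assoc_mult_mat[OF s X T, symmetric])
    moreover have "transpose_mat (\<epsilon> \<cdot>\<^sub>m 1\<^sub>m (dim_at k)) = \<epsilon> \<cdot>\<^sub>m 1\<^sub>m (dim_at k)"
      by (rule eq_matI) auto
    ultimately show "transpose_mat (W k) = W k"
      unfolding W_def using transpose_add[OF Y[OF k], of "\<epsilon> \<cdot>\<^sub>m 1\<^sub>m (dim_at k)"] by simp
    fix v :: "real vec" assume v: "v \<in> carrier_vec (dim_at k)" "v \<noteq> 0\<^sub>v (dim_at k)"
    \<comment> \<open>\<open>u\<close> is \<open>v\<close> padded with zeros outside the clique; the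
      form of \<open>Y k\<close> at \<open>v\<close> is the form of \<open>V k\<close> at
      \<open>u\<close>.\<close>
    define u where "u = ?T *\<^sub>v v"
    have u: "u \<in> carrier_vec n" using T v by (simp add: u_def)
    have Xu: "X k *\<^sub>v u \<in> carrier_vec n" using X[of k] u by simp
    have "Y k *\<^sub>v v = sel k *\<^sub>v (X k *\<^sub>v u)"
      unfolding Y_def assoc_mult_mat_vec[OF sX T v(1)] u_def[symmetric] assoc_mult_mat_vec[OF s X u] ..
    then have "v \<bullet> (Y k *\<^sub>v v) = u \<bullet> (X k *\<^sub>v u)"
      using transpose_move[OF s v(1) Xu] by (simp add: u_def)
    also have "\<dots> = qform {..<n} (V k) (($) u)"
      unfolding qform_mat[OF X u] unfolding qform_def by (intro sum.cong) (auto simp: X_def)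
    also have "\<dots> \<ge> 0" using V(1)[OF k] by (simp add: psd_on_def)
    finally have "0 \<le> v \<bullet> (Y k *\<^sub>v v)" .
    moreover have "(\<epsilon> \<cdot>\<^sub>m 1\<^sub>m (dim_at k)) *\<^sub>v v = \<epsilon> \<cdot>\<^sub>v v"
      using v by (intro eq_vecI) (auto simp: smult_scalar_prod_distrib[where n = "dim_at k"])
    then have "v \<bullet> (W k *\<^sub>v v) = v \<bullet> (Y k *\<^sub>v v) + \<epsilon> * (v \<bullet> v)"
      unfolding W_def using Y[OF k] v
      by (simp add: add_mult_distrib_mat_vec[where nr = "dim_at k" and nc = "dim_at k"]
          scalar_prod_add_distrib[where n = "dim_at k"])
    ultimately show "0 < v \<bullet> (W k *\<^sub>v v)"
      using \<epsilon>(1) scalar_prod_self_pos[OF v] by (simp add: add_nonneg_pos)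
  qed
  have "blkdiag q W \<in> DDpp d q C" unfolding DDpp_def using W W_pd by blast
  moreover have "transpose_mat E * blkdiag q W * E = P"
  proof (rule eq_matI)
    fix \<alpha> \<beta> assume "\<alpha> < dim_row P" "\<beta> < dim_col P"
    then have lt: "\<alpha> < n" "\<beta> < n" using Pc by auto
    have "(transpose_mat E * blkdiag q W * E) $$ (\<alpha>, \<beta>) =
        (\<Sum>k\<in>{1..q}. (transpose_mat (sel k) * W k * sel k) $$ (\<alpha>, \<beta>))"
      by (rule congruence_entry[OF _ lt]) (use W in blast)
    \<comment> \<open>The multiples of the identity in the blocks add up to
      \<open>\<epsilon>\<close> times the Gram matrix, exactly what was taken from
      \<open>P\<close>.\<close>
    also have "\<dots> = (\<Sum>k\<in>{1..q}. V k \<alpha> \<beta> + \<epsilon> * (transpose_mat (sel k) * sel k) $$ (\<alpha>, \<beta>))"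
    proof (rule sum.cong)
      fix k assume k: "k \<in> {1..q}"
      let ?T = "transpose_mat (sel k)"
      have s: "sel k \<in> carrier_mat (dim_at k) n" and T: "?T \<in> carrier_mat n (dim_at k)"
        using sel_carrier[OF k] by auto
      have TY: "?T * Y k \<in> carrier_mat n (dim_at k)" by (rule mult_carrier_mat[OF T Y[OF k]])
      have "?T * (\<epsilon> \<cdot>\<^sub>m 1\<^sub>m (dim_at k)) = \<epsilon> \<cdot>\<^sub>m (?T * 1\<^sub>m (dim_at k))"
        by (rule mult_smult_distrib[OF T one_carrier_mat])
      also have "?T * 1\<^sub>m (dim_at k) = ?T" by (rule right_mult_one_mat[OF T])
      finally have "?T * W k = ?T * Y k + \<epsilon> \<cdot>\<^sub>m ?T"
        unfolding W_def using mult_add_distrib_mat[OF T Y[OF k], of "\<epsilon> \<cdot>\<^sub>m 1\<^sub>m (dim_at k)"] by simp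
      then have "?T * W k * sel k = ?T * Y k * sel k + (\<epsilon> \<cdot>\<^sub>m ?T) * sel k"
        using add_mult_distrib_mat[OF TY _ s, of "\<epsilon> \<cdot>\<^sub>m ?T"] T by simp
      also have "?T * Y k * sel k = X k" unfolding Y_def using S(2) k by blast
      also have "(\<epsilon> \<cdot>\<^sub>m ?T) * sel k = \<epsilon> \<cdot>\<^sub>m (?T * sel k)" by (rule mult_smult_assoc_mat[OF T s])
      finally show "(?T * W k * sel k) $$ (\<alpha>, \<beta>) = V k \<alpha> \<beta> + \<epsilon> * (?T * sel k) $$ (\<alpha>, \<beta>)"
        using lt s T X[of k] by (simp add: X_def)
    qed simp
    also have "\<dots> = R \<alpha> \<beta> + \<epsilon> * mat_diag n cnt $$ (\<alpha>, \<beta>)"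
      unfolding sum.distrib V(3) sum_distrib_left[symmetric] gram_entry[OF lt, symmetric] gram_eq ..
    also have "\<dots> = P $$ (\<alpha>, \<beta>)" using lt by (simp add: R_def)
    finally show "(transpose_mat E * blkdiag q W * E) $$ (\<alpha>, \<beta>) = P $$ (\<alpha>, \<beta>)" .
  qed (use Pc congruence_carrier[OF blkdiag_carrier, of W] W in auto)
  ultimately show thesis by (rule that)
qed

section \<open>Comparison of the two sets of gains\<close>

context
  fixes A B :: "real mat"
  assumes A: "A \<in> carrier_mat n n" and B: "B \<in> carrier_mat n n"
begin

lemma lmi_iff:
  assumes Q: "Q \<in> DDpp d q C" and W: "W \<in> DDpp d q C" and QW: "Q * W = 1\<^sub>m m" and WQ: "W * Q = 1\<^sub>m m"
    and Z: "Z \<in> DD d q C"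
  shows "(\<exists>\<rho>. neg_def (Phi (lift_mat E A) (lift_mat E B) Q Z + \<rho> \<cdot>\<^sub>m (Q * M_mat E * Q))) \<longleftrightarrow>
    neg_def (transpose_mat (A + B * (F * (Z * W) * E)) * (transpose_mat E * W * E) +
      (transpose_mat E * W * E) * (A + B * (F * (Z * W) * E)))"
proof -
  have c: "Q \<in> carrier_mat m m" "W \<in> carrier_mat m m" "Z \<in> carrier_mat m m"
    using Q W Z DDpp_subset_DD DD_carrier by blast+
  show ?thesis
    by (rule lifted_lyapunov_iff[OF E_carrier A B gram_inverse_props(1,2,4) c(1,2) QW WQ _ _ c(3)])
      (use pos_defD(1)[OF DDpp_pos_def] Q W c in auto)
qed

text \<open>For fixed \<open>Q\<close> the map from \<open>Z\<close> to \<open>Z * minv Q\<close> is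
  a bijection of \<open>DD\<close>, so gain and Lyapunov matrix acquire parameters \<open>Kt\<close>
  and \<open>W\<close> that can be chosen separately.\<close>

lemma K_S_hat_iff:
  "K \<in> K_S_hat N d q C A B \<longleftrightarrow> (\<exists>Kt\<in>DD d q C. \<exists>W\<in>DDpp d q C. K = F * Kt * E \<and>
    neg_def (transpose_mat (A + B * K) * (transpose_mat E * W * E) + (transpose_mat E * W * E) * (A + B * K)))"
  (is "_ \<longleftrightarrow> ?R")
proof
  assume "K \<in> K_S_hat N d q C A B"
  then obtain Z Q where K: "K = F * (Z * minv Q) * E" and Z: "Z \<in> DD d q C" and Q: "Q \<in> DDpp d q C"
    and \<rho>: "\<exists>\<rho>. neg_def (Phi (lift_mat E A) (lift_mat E B) Q Z + \<rho> \<cdot>\<^sub>m (Q * M_mat E * Q))"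
    unfolding K_S_hat_def Let_def by blast
  obtain W where W: "W \<in> DDpp d q C" "Q * W = 1\<^sub>m m" "W * Q = 1\<^sub>m m" using DDpp_inverse[OF Q] .
  have "Q \<in> carrier_mat m m" "W \<in> carrier_mat m m" using Q W(1) DDpp_subset_DD DD_carrier by blast+
  then have "minv Q = W" using W by (intro minv_eq)
  moreover have "Z * W \<in> DD d q C" using DD_mult[OF Z] W(1) DDpp_subset_DD by blast
  ultimately show ?R using \<rho> unfolding lmi_iff[OF Q W Z] K by (metis W(1))
next
  assume ?R
  then obtain Kt W where Kt: "Kt \<in> DD d q C" and W: "W \<in> DDpp d q C" and K: "K = F * Kt * E"
    and neg: "neg_def (transpose_mat (A + B * K) * (transpose_mat E * W * E) + (transpose_mat E * W * E) * (A + B * K))"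
    by blast
  obtain Q where Q: "Q \<in> DDpp d q C" "W * Q = 1\<^sub>m m" "Q * W = 1\<^sub>m m" using DDpp_inverse[OF W] .
  have c: "Q \<in> carrier_mat m m" "W \<in> carrier_mat m m" "Kt \<in> carrier_mat m m"
    using Q(1) W Kt DDpp_subset_DD DD_carrier by blast+
  have inv: "minv Q = W" using c Q by (intro minv_eq)
  have Z: "Kt * Q \<in> DD d q C" using DD_mult[OF Kt] Q(1) DDpp_subset_DD by blast
  have ZW: "Kt * Q * W = Kt" using assoc_mult_mat[OF c(3,1,2)] Q(3) c by simp
  have "\<exists>\<rho>. neg_def (Phi (lift_mat E A) (lift_mat E B) Q (Kt * Q) + \<rho> \<cdot>\<^sub>m (Q * M_mat E * Q))"
    unfolding lmi_iff[OF Q(1) W Q(3,2) Z] ZW K[symmetric] by (rule neg)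
  then show "K \<in> K_S_hat N d q C A B"
    unfolding K_S_hat_def Let_def using Z Q(1) K ZW inv by (intro CollectI exI[of _ "Kt * Q"] exI[of _ Q]) simp
qed

lemma K_S_hat_subset: "K_S_hat N d q C A B \<subseteq> K_S G N d A B"
proof
  fix K assume "K \<in> K_S_hat N d q C A B"
  then obtain Kt W where Kt: "Kt \<in> DD d q C" and W: "W \<in> DDpp d q C" and K: "K = F * Kt * E"
    and neg: "neg_def (transpose_mat (A + B * K) * (transpose_mat E * W * E) + (transpose_mat E * W * E) * (A + B * K))"
    unfolding K_S_hat_iff by blast
  have "K \<in> sparse_mats G N d" using Kt K sparse_iff_congruence by blast
  moreover have "transpose_mat E * W * E \<in> sparse_mats G N d"
    using DD_congruence_sparse W DDpp_subset_DD by blast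
  ultimately show "K \<in> K_S G N d A B"
    unfolding K_S_def using neg congruence_pos_def[OF W] by blast
qed

text \<open>Since the parameters are independent, \<open>K\<close> and \<open>P\<close> can be
  decomposed each on its own; only the decomposition of \<open>P\<close> draws on chordality and
  maximality.\<close>

lemma K_S_subset_hat:
  assumes "chordal G" "C ` {1..q} = {S. is_maximal_clique G S}"
  shows "K_S G N d A B \<subseteq> K_S_hat N d q C A B"
proof
  fix K assume "K \<in> K_S G N d A B"
  then obtain P where K: "K \<in> sparse_mats G N d" and P: "P \<in> sparse_mats G N d" "pos_def P"
    and neg: "neg_def (transpose_mat (A + B * K) * P + P * (A + B * K))"
    unfolding K_S_def by blast
  obtain Kt where "Kt \<in> DD d q C" "K = F * Kt * E" using K sparse_iff_congruence by blast
  moreover obtain W where "W \<in> DDpp d q C" "transpose_mat E * W * E = P"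
    using pos_def_decompose[OF assms P] .
  ultimately show "K \<in> K_S_hat N d q C A B"
    unfolding K_S_hat_iff using neg by blast
qed

end

end

theorem theorem1:
  fixes G :: "nat pair_pre_digraph"
    and N q :: nat
    and d :: "nat \<Rightarrow> nat"
    and C :: "nat \<Rightarrow> nat set"
    and A B :: "real mat"
  assumes "pair_graph G" and "pverts G = {1..N}"
    and "\<forall>i\<in>{1..N}. 0 < d i"
    and "\<forall>k\<in>{1..q}. is_clique G (C k)" and "inj_on C {1..q}"
    and "A \<in> carrier_mat (total_dim N d) (total_dim N d)"
    and "B \<in> carrier_mat (total_dim N d) (total_dim N d)"
    and "\<forall>i\<in>{1..N}. clique_indices q C i \<noteq> {}"
    and "\<forall>i\<in>{1..N}. \<forall>j\<in>{1..N}. i \<noteq> j \<longrightarrow>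
           (clique_indices q C i \<inter> clique_indices q C j \<noteq> {} \<longleftrightarrow> (i, j) \<in> parcs G)"
  shows "K_S_hat N d q C A B \<subseteq> K_S G N d A B \<and>
    (chordal G \<and> C ` {1..q} = {S. is_maximal_clique G S} \<longrightarrow>
       K_S_hat N d q C A B = K_S G N d A B)"
proof -
  interpret clique_cover G N q d C
  proof (rule clique_cover.intro)
    show "pair_graph G" "pverts G = {1..N}" by fact+
    show "is_clique G (C k)" if "k \<in> {1..q}" for k using assms(4) that by metis
    show "clique_indices q C i \<noteq> {}" if "i \<in> {1..N}" for i using assms(8) that by metis
    show "clique_indices q C i \<inter> clique_indices q C j \<noteq> {} \<longleftrightarrow> (i, j) \<in> parcs G"
      if "i \<in> {1..N}" "j \<in> {1..N}" "i \<noteq> j" for i j using assms(9) that by metis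
  qed
  note sub = K_S_hat_subset[OF assms(6,7)]
  show ?thesis
  proof (intro conjI impI sub)
    assume "chordal G \<and> C ` {1..q} = {S. is_maximal_clique G S}"
    then show "K_S_hat N d q C A B = K_S G N d A B"
      using sub K_S_subset_hat[OF assms(6,7)] by (intro subset_antisym) simp_all
  qed
qed

end
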